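(* Let $n\ge1$ and $0<\alpha<\pi$. For every compact set $Q\subset\mathbb{T}$ with $\mathrm{mes}(Q)=2\alpha$, $$U_n(Q)\ge\sin^{2n}\frac\alpha2,$$ with equality if and only if $Q$ is one of the segments $I_k(2\alpha)=\left[-\alpha+\frac{k\pi}n,\alpha+\frac{k\pi}n\right]$, $k\in\mathbb{Z}$ (taken modulo $2\pi$). Consequently $U_n(2\alpha)=\sin^{2n}\frac\alpha2$.
   Context: $\mathbb{T}=[0,2\pi)$ with endpoints identified, with Lebesgue measure $\mathrm{mes}$. $\mathcal{F}_{n-1}$ is the set of real trigonometric polynomials of order at most $n-1$. For compact $Q\subset\mathbb{T}$, $U_n(Q)=\inf\{\max_{t\in Q}|\cos nt-f_{n-1}(t)|:f_{n-1}\in\mathcal{F}_{n-1}\}$, and $U_n(2\alpha)=\inf\{U_n(Q):Q\subset\mathbb{T}\text{ compact},\ \mathrm{mes}(Q)=2\alpha\}$. *)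

theory Defs
  imports "HOL-Analysis.Analysis"
begin

text \<open>The circle T = R / 2 pi Z.  A subset of T is represented by its 2 pi-periodic
  preimage in R.  A subset of T is compact iff its periodic preimage is closed in R.\<close>

definition periodic_set :: "real set \<Rightarrow> bool" where
  "periodic_set Q \<longleftrightarrow> (\<forall>t. t \<in> Q \<longleftrightarrow> t + 2 * pi \<in> Q)"

definition torus_compact :: "real set \<Rightarrow> bool" where
  "torus_compact Q \<longleftrightarrow> closed Q \<and> periodic_set Q"

definition torus_mes :: "real set \<Rightarrow> real" where
  "torus_mes Q = measure lebesgue (Q \<inter> {0..<2 * pi})"

definition trig_poly :: "nat \<Rightarrow> (real \<Rightarrow> real) \<Rightarrow> bool" where
  "trig_poly m f \<longleftrightarrow> (\<exists>a b :: nat \<Rightarrow> real.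
      f = (\<lambda>t. \<Sum>k\<le>m. a k * cos (real k * t) + b k * sin (real k * t)))"

definition U_set :: "nat \<Rightarrow> real set \<Rightarrow> real" where
  "U_set n Q = Inf ((\<lambda>f. Sup ((\<lambda>t. \<bar>cos (real n * t) - f t\<bar>) ` Q)) ` {f. trig_poly (n - 1) f})"

definition U_mes :: "nat \<Rightarrow> real \<Rightarrow> real" where
  "U_mes n a = Inf {U_set n Q | Q. torus_compact Q \<and> torus_mes Q = a}"

definition seg :: "nat \<Rightarrow> real \<Rightarrow> int \<Rightarrow> real set" where
  "seg n \<alpha> k = {t. \<exists>m::int. \<bar>t - real_of_int k * pi / real n - 2 * pi * real_of_int m\<bar> \<le> \<alpha>}"

end

theory Submission
  imports Defs "HOL-Complex_Analysis.Conformal_Mappings"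
begin

text \<open>Put \<open>z = e\<^sup>i\<^sup>t\<close>, so that \<open>2 z\<^sup>n (cos nt - f(t))\<close> is a self-reciprocal polynomial \<open>P\<close> of degree \<open>2n\<close>
  with \<open>P(0) = 1\<close>, and suppose \<open>\<bar>P\<bar> \<le> 2M\<close> on the circle set \<open>E\<close> belonging to \<open>Q\<close>. The harmonic measure of
  \<open>E\<close> yields a holomorphic \<open>\<phi>_inf\<close> from the complement \<open>\<Omega>\<close> of \<open>E\<close> into the unit disc that vanishes at
  infinity and takes the value \<open>sin (\<alpha>/2)\<close> at 0. With \<open>J\<close> the inverse Joukowski map, the function
  \<open>G = J(P / (2 M z\<^sup>n)) z\<^sup>n \<phi>_inf\<^sup>2\<^sup>n\<close> has boundary values of modulus at most 1, hence
  \<open>sin (\<alpha>/2)\<^sup>2\<^sup>n / M = G(0) \<le> 1\<close>.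

  If equality holds then \<open>G = 1\<close> on \<open>\<Omega>\<close>. Comparing this identity with its mirror image in the circle,
  the quotient \<open>\<phi>_0 / \<phi>_inf\<close> is a rotation \<open>c z\<close>, where \<open>\<phi>_0\<close> is the analogue of \<open>\<phi>_inf\<close> vanishing at 0. An
  explicit formula for this quotient on the circle places the complement of \<open>Q\<close> inside an open arc of
  length \<open>2\<pi> - 2\<alpha>\<close>, so \<open>Q\<close> contains a closed arc of length \<open>2\<alpha>\<close>. The same argument applied to that arc
  gives \<open>\<bar>P\<bar> > 2M\<close> off it, so \<open>Q\<close> is the arc; at the middle of the gap \<open>z\<^sup>n\<close> is real, which fixes the
  centre. Extremal \<open>P\<close> exist by compactness, and on an arc a Chebyshev polynomial attains the
  bound.\<close>

section \<open>The Herglotz integral of a subset of the circle\<close>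

text \<open>Up to the factor \<open>\<pi> / 4\<close>, the Herglotz integral of the indicator function of \<open>E\<close>.\<close>

definition slit_potential :: "real set \<Rightarrow> complex \<Rightarrow> complex" where
  "slit_potential E z = (LINT t:E|lborel. (cis t + z) / (cis t - z)) / 8"

text \<open>Provides the uniform lower bound on \<open>norm (cis t - z)\<close> that makes the
  kernel bounded, hence integrable, on \<open>E\<close>, and that later dominates the difference
  quotients.\<close>

lemma closed_cis_image_dist:
  assumes "closed (cis ` E)" "z \<notin> cis ` E"
  obtains d where "d > 0" "\<And>t. t \<in> E \<Longrightarrow> d \<le> norm (cis t - z)"
proof (cases "E = {}")
  case False
  have "infdist z (cis ` E) > 0"
    using assms False in_closed_iff_infdist_zero[of "cis ` E" z] infdist_nonneg[of z "cis ` E"]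
    by (auto simp: less_le)
  moreover have "infdist z (cis ` E) \<le> norm (cis t - z)" if "t \<in> E" for t
    using infdist_le[of "cis t" "cis ` E" z] that by (simp add: dist_norm norm_minus_commute)
  ultimately show ?thesis using that by blast
qed (use that[of 1] in auto)

lemma set_integrable_bounded_lborel:
  fixes f :: "real \<Rightarrow> 'a :: {banach, second_countable_topology}"
  assumes "E \<in> sets borel" "bounded E" "f \<in> borel_measurable borel"
    and "\<And>t. t \<in> E \<Longrightarrow> norm (f t) \<le> B"
  shows "set_integrable lborel E f"
proof -
  have "emeasure lborel E < \<infinity>"
    using assms(1,2) emeasure_bounded_finite by auto
  hence "set_integrable lborel E (\<lambda>_. B)"
    unfolding set_integrable_def using assms(1) by (auto intro!: integrable_mult_left)
  thus ?thesis
    by (rule set_integrable_bound)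
       (use assms in \<open>auto simp: set_borel_measurable_def intro!: AE_I2 order_trans[OF _ abs_ge_self]\<close>)
qed

lemma cis_borel_measurable [measurable]: "cis \<in> borel_measurable borel"
  by (intro borel_measurable_continuous_onI continuous_intros)

lemma cis_inj_on: "inj_on cis {0..<2*pi}"
proof (rule inj_on_inverseI)
  fix u :: real assume u: "u \<in> {0..<2*pi}"
  have "of_real 1 * exp (\<i> * of_real u) = cis u"
    by (simp only: cis_conv_exp of_real_1 mult_1)
  from Arg2pi_unique[OF this] u show "Arg2pi (cis u) = u" by simp
qed

locale slit_circle =
  fixes E :: "real set" and \<alpha> :: real
  assumes E_borel: "E \<in> sets borel"
    and E_sub: "E \<subseteq> {0..<2*pi}"
    and E_closed: "closed (cis ` E)"
    and E_measure: "measure lborel E = 2 * \<alpha>"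
    and \<alpha>_pos: "0 < \<alpha>" and \<alpha>_lt: "\<alpha> < pi"
begin

definition \<Omega> :: "complex set" where "\<Omega> = - (cis ` E)"

abbreviation X :: "complex \<Rightarrow> complex" where "X \<equiv> slit_potential E"

lemma open_\<Omega>: "open \<Omega>"
  using E_closed by (simp add: \<Omega>_def open_Compl)

lemma bounded_E: "bounded E"
  using E_sub by (intro bounded_subset[OF bounded_closed_interval[of 0 "2*pi"]]) auto

lemma kernel_integrable:
  assumes "z \<in> \<Omega>"
  shows "set_integrable lborel E (\<lambda>t. (cis t + z) / (cis t - z))"
proof -
  obtain d where d: "d > 0" "\<And>t. t \<in> E \<Longrightarrow> d \<le> norm (cis t - z)"
    using closed_cis_image_dist[OF E_closed] assms unfolding \<Omega>_def by blast
  have "norm ((cis t + z) / (cis t - z)) \<le> (1 + norm z) / d" if "t \<in> E" for t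
    unfolding norm_divide using d that norm_triangle_ineq[of "cis t" z]
    by (intro frac_le) auto
  thus ?thesis
    by (intro set_integrable_bounded_lborel[OF E_borel bounded_E]) auto
qed

text \<open>Subtracting the two kernels leaves \<open>2 * (z - w) * cis t\<close> over the product
  of the denominators, so the difference quotient is again an integral over
  \<open>E\<close>.\<close>

lemma slit_potential_diff:
  assumes "z \<in> \<Omega>" "w \<in> \<Omega>"
  shows "X z - X w = (z - w) * ((LINT t:E|lborel. cis t / ((cis t - z) * (cis t - w))) / 4)"
proof -
  have ne: "cis t \<noteq> z" "cis t \<noteq> w" if "t \<in> E" for t
    using assms that by (auto simp: \<Omega>_def)
  have "X z - X w = (LINT t:E|lborel. (cis t + z) / (cis t - z) - (cis t + w) / (cis t - w)) / 8"
    by (simp add: slit_potential_def set_integral_diff kernel_integrable assms diff_divide_distrib)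
  also have "(LINT t:E|lborel. (cis t + z) / (cis t - z) - (cis t + w) / (cis t - w))
      = (LINT t:E|lborel. (2 * (z - w)) * (cis t / ((cis t - z) * (cis t - w))))"
    using E_borel ne by (intro set_lebesgue_integral_cong) (auto simp: field_simps)
  also have "\<dots> = (2 * (z - w)) * (LINT t:E|lborel. (cis t / ((cis t - z) * (cis t - w))))"
    by (rule set_integral_mult_right)
  also have "\<dots> / 8 = (z - w) * ((LINT t:E|lborel. cis t / ((cis t - z) * (cis t - w))) / 4)"
    by (simp add: field_simps)
  finally show ?thesis .
qed

lemma slit_potential_has_derivative:
  assumes "w \<in> \<Omega>"
  shows "(X has_field_derivative ((LINT t:E|lborel. cis t / ((cis t - w) * (cis t - w))) / 4)) (at w)"
proof -
  obtain d where d: "d > 0" "\<And>t. t \<in> E \<Longrightarrow> d \<le> norm (cis t - w)"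
    using closed_cis_image_dist[OF E_closed] assms unfolding \<Omega>_def by blast
  let ?g = "\<lambda>z. LINT t:E|lborel. cis t / ((cis t - z) * (cis t - w))"
  have "(?g \<longlongrightarrow> ?g w) (at w)"
    unfolding tendsto_at_iff_sequentially comp_def
  proof (intro allI impI)
    fix S assume S: "\<forall>i. S i \<in> UNIV - {w}" "S \<longlonglongrightarrow> w"
    have "\<forall>\<^sub>F i in sequentially. dist (S i) w < d / 2"
      using tendstoD[OF S(2), of "d / 2"] d(1) by simp
    then obtain N where N: "\<And>i. i \<ge> N \<Longrightarrow> dist (S i) w < d / 2"
      by (auto simp: eventually_sequentially)
    \<comment> \<open>From index \<open>N\<close> on the points stay within \<open>d / 2\<close> of
      \<open>w\<close>, so the integrands are dominated by the constant
      \<open>1 / (d / 2 * d)\<close>.\<close>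
    have lower: "d / 2 \<le> norm (cis t - S (i + N))" if "t \<in> E" for t i
    proof -
      have "norm (cis t - w) \<le> norm (cis t - S (i + N)) + norm (S (i + N) - w)"
        using norm_triangle_ineq[of "cis t - S (i + N)" "S (i + N) - w"] by simp
      with d(2)[OF that] N[of "i + N"] show ?thesis by (simp add: dist_norm)
    qed
    have "(\<lambda>i. ?g (S (i + N))) \<longlonglongrightarrow> ?g w"
      unfolding set_lebesgue_integral_def
    proof (rule integral_dominated_convergence)
      show "integrable lborel (\<lambda>t. indicat_real E t *\<^sub>R (1 / (d / 2 * d)))"
        using set_integrable_bounded_lborel[OF E_borel bounded_E, of "\<lambda>_. 1 / (d / 2 * d)"]
        unfolding set_integrable_def by auto
      show "AE t in lborel. (\<lambda>i. indicat_real E t *\<^sub>R (cis t / ((cis t - S (i + N)) * (cis t - w))))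
          \<longlonglongrightarrow> indicat_real E t *\<^sub>R (cis t / ((cis t - w) * (cis t - w)))"
      proof (intro AE_I2)
        fix t
        show "(\<lambda>i. indicat_real E t *\<^sub>R (cis t / ((cis t - S (i + N)) * (cis t - w))))
          \<longlonglongrightarrow> indicat_real E t *\<^sub>R (cis t / ((cis t - w) * (cis t - w)))"
        proof (cases "t \<in> E")
          case True
          have "cis t \<noteq> w" using True assms by (auto simp: \<Omega>_def)
          thus ?thesis
            by (intro tendsto_intros LIMSEQ_ignore_initial_segment S(2)) auto
        qed auto
      qed
      show "AE t in lborel. norm (indicat_real E t *\<^sub>R (cis t / ((cis t - S (i + N)) * (cis t - w))))
          \<le> indicat_real E t *\<^sub>R (1 / (d / 2 * d))" for i
      proof (intro AE_I2)
        fix t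
        have "norm (cis t / ((cis t - S (i + N)) * (cis t - w))) \<le> 1 / (d / 2 * d)" if "t \<in> E"
          unfolding norm_divide norm_mult using d lower[OF that, of i] that
          by (intro frac_le mult_mono) auto
        thus "norm (indicat_real E t *\<^sub>R (cis t / ((cis t - S (i + N)) * (cis t - w))))
          \<le> indicat_real E t *\<^sub>R (1 / (d / 2 * d))"
          by (auto simp: indicator_def)
      qed
    qed (use E_borel in auto)
    thus "(\<lambda>i. ?g (S i)) \<longlonglongrightarrow> ?g w"
      by (rule LIMSEQ_offset)
  qed
  hence lim: "((\<lambda>z. ?g z / 4) \<longlongrightarrow> ?g w / 4) (at w)"
    by (intro tendsto_intros) auto
  have "\<forall>\<^sub>F z in at w. ?g z / 4 = (X z - X w) / (z - w)"
    unfolding eventually_at_topological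
    using open_\<Omega> assms slit_potential_diff[OF _ assms] by (intro exI[of _ \<Omega>]) auto
  hence "((\<lambda>z. (X z - X w) / (z - w)) \<longlongrightarrow> ?g w / 4) (at w)"
    using lim by (rule Lim_transform_eventually[rotated])
  thus ?thesis by (simp add: has_field_derivative_iff)
qed

lemma slit_potential_holomorphic: "X holomorphic_on \<Omega>"
  using slit_potential_has_derivative open_\<Omega> by (auto simp: holomorphic_on_open)

lemma slit_potential_0: "X 0 = of_real (\<alpha> / 4)"
proof -
  have "(LINT t:E|lborel. (cis t + 0) / (cis t - 0)) = (LINT t:E|lborel. (1::complex))"
    using E_borel by (intro set_lebesgue_integral_cong) auto
  also have "\<dots> = of_real (2 * \<alpha>)"
    using E_measure E_borel emeasure_bounded_finite[OF bounded_E]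
    by (simp add: set_lebesgue_integral_def scaleR_conv_of_real)
  finally show ?thesis by (simp add: slit_potential_def)
qed

text \<open>Since \<open>cnj (cis t) = 1 / cis t\<close>, inversion in the circle turns the kernel
  into minus its conjugate, pointwise in \<open>t\<close>.\<close>

lemma slit_potential_reflect:
  assumes "z \<in> \<Omega>" "z \<noteq> 0"
  shows "X (1 / cnj z) = - cnj (X z)"
proof -
  have "(LINT t:E|lborel. (cis t + 1 / cnj z) / (cis t - 1 / cnj z))
      = (LINT t:E|lborel. - cnj ((cis t + z) / (cis t - z)))"
  proof (intro set_lebesgue_integral_cong allI impI)
    fix t assume "t \<in> E"
    hence ne: "cis t \<noteq> z" using assms by (auto simp: \<Omega>_def)
    hence ne': "cnj (cis t) \<noteq> cnj z" by simp
    have c: "cnj (cis t) = 1 / cis t" by (simp add: cis_cnj divide_inverse)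
    have "1 / cis t \<noteq> cnj z" using ne' c by simp
    hence "cis t * cnj z \<noteq> 1" by (auto simp: field_simps)
    thus "(cis t + 1 / cnj z) / (cis t - 1 / cnj z) = - cnj ((cis t + z) / (cis t - z))"
      using assms(2) ne by (simp add: c field_simps)
  qed (use E_borel in auto)
  also have "\<dots> = - cnj (LINT t:E|lborel. (cis t + z) / (cis t - z))"
    unfolding set_lebesgue_integral_def
    by (simp only: scaleR_minus_right integral_minus flip: complex_cnj_scaleR)
       (simp only: Bochner_Integration.integral_cnj)
  finally show ?thesis by (simp add: slit_potential_def)
qed

end

section \<open>The Poisson kernel and the range of the potential\<close>

text \<open>This real part is the Poisson kernel: positive inside the disc, zero on the circle away
  from its pole.\<close>

lemma Re_herglotz_kernel:
  "Re ((cis t + z) / (cis t - z)) = (1 - (norm z)\<^sup>2) / (norm (cis t - z))\<^sup>2"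
proof -
  have "Re ((cis t + z) / (cis t - z)) = Re ((cis t + z) * cnj (cis t - z)) / (norm (cis t - z))\<^sup>2"
    by (subst complex_div_cnj) (simp del: complex_cnj_diff flip: of_real_power)
  also have "Re ((cis t + z) * cnj (cis t - z)) = 1 - (norm z)\<^sup>2"
    unfolding cmod_power2 using sin_cos_squared_add[of t] by (simp add: algebra_simps power2_eq_square)
  finally show ?thesis .
qed

lemma Re_set_integral:
  fixes f :: "real \<Rightarrow> complex"
  assumes "set_integrable lborel A f"
  shows "Re (LINT t:A|lborel. f t) = (LINT t:A|lborel. Re (f t))"
  using assms by (simp add: set_lebesgue_integral_def set_integrable_def flip: integral_Re)

lemma herglotz_kernel_integrable_disc:
  assumes "norm z < 1" "A \<in> sets borel" "bounded A"
  shows "set_integrable lborel A (\<lambda>t. (cis t + z) / (cis t - z))"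
proof (intro set_integrable_bounded_lborel assms)
  fix t assume "t \<in> A"
  show "norm ((cis t + z) / (cis t - z)) \<le> (1 + norm z) / (1 - norm z)"
    unfolding norm_divide using assms(1) norm_triangle_ineq[of "cis t" z] norm_triangle_ineq2[of "cis t" z]
    by (intro frac_le) auto
qed auto

lemma herglotz_integral_circle:
  assumes "norm z < 1"
  shows "(LINT t:{0..<2*pi}|lborel. (cis t + z) / (cis t - z)) = of_real (2 * pi)"
proof -
  have nz: "cis t \<noteq> z" for t using assms by auto
  have "((\<lambda>u. 1 / (u - z)) has_contour_integral (2 * of_real pi * \<i> * 1)) (circlepath 0 1)"
    using assms by (intro Cauchy_integral_circlepath) auto
  hence "((\<lambda>t. 1 / (cis t - z) * 1 * \<i> * cis t) has_integral (2 * of_real pi * \<i>)) {0..2*pi}"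
    unfolding circlepath_def by (subst (asm) has_contour_integral_part_circlepath_iff) auto
  \<comment> \<open>The kernel equals \<open>2 * cis t / (cis t - z) - 1\<close>. Cauchy's formula
    for the constant 1 gives \<open>4 * pi\<close> for the first term, and the second removes
    \<open>2 * pi\<close>.\<close>
  hence "((\<lambda>t. (2 / \<i>) * (1 / (cis t - z) * 1 * \<i> * cis t) - 1) has_integral
      ((2 / \<i>) * (2 * of_real pi * \<i>) - (2 * pi - 0) *\<^sub>R 1)) {0..2*pi}"
    using has_integral_const_real[of "1::complex" 0 "2*pi"]
    by (intro has_integral_diff has_integral_mult_right) auto
  also have "(\<lambda>t. (2 / \<i>) * (1 / (cis t - z) * 1 * \<i> * cis t) - 1) = (\<lambda>t. (cis t + z) / (cis t - z))"
    using nz by (intro ext) (simp add: field_simps)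
  also have "(2 / \<i>) * (2 * of_real pi * \<i>) - (2 * pi - 0) *\<^sub>R 1 = complex_of_real (2 * pi)"
    by (simp add: scaleR_conv_of_real field_simps)
  finally have "integral {0..2*pi} (\<lambda>t. (cis t + z) / (cis t - z)) = of_real (2 * pi)"
    by (rule integral_unique)
  moreover have "(LINT t:{0..<2*pi}|lborel. (cis t + z) / (cis t - z))
      = integral {0..2*pi} (\<lambda>t. (cis t + z) / (cis t - z))"
    using interval_integral_Ico[of 0 "2*pi" "\<lambda>t. (cis t + z) / (cis t - z)"]
      interval_integral_eq_integral[of 0 "2*pi" "\<lambda>t. (cis t + z) / (cis t - z)"]
      herglotz_kernel_integrable_disc[OF assms, of "{0..2*pi}"] by simp
  ultimately show ?thesis by simp
qed

text \<open>Harnack's inequality: \<open>norm (cis t - z) \<le> 1 + norm z\<close> bounds the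
  Poisson kernel below by a positive constant, which is then integrated over
  \<open>A\<close>.\<close>

lemma Re_herglotz_integral_ge:
  assumes "norm z < 1" "A \<in> sets borel" "bounded A"
  shows "(1 - norm z) / (1 + norm z) * measure lborel A
    \<le> Re (LINT t:A|lborel. (cis t + z) / (cis t - z))"
proof -
  have i: "set_integrable lborel A (\<lambda>t. (cis t + z) / (cis t - z))"
    using herglotz_kernel_integrable_disc assms by blast
  have c: "set_integrable lborel A (\<lambda>t. (1 - norm z) / (1 + norm z))"
    by (rule set_integrable_bounded_lborel[OF assms(2,3)]) auto
  have "(1 - norm z) / (1 + norm z) * measure lborel A = (LINT t:A|lborel. (1 - norm z) / (1 + norm z))"
    using assms(2) by (simp add: set_lebesgue_integral_def)
  also have "\<dots> \<le> (LINT t:A|lborel. Re ((cis t + z) / (cis t - z)))"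
  proof (rule set_integral_mono[OF c])
    show "set_integrable lborel A (\<lambda>t. Re ((cis t + z) / (cis t - z)))"
      using i unfolding set_integrable_def by (auto dest: integrable_Re)
    fix t assume "t \<in> A"
    have n: "norm (cis t - z) \<le> 1 + norm z" using norm_triangle_ineq4[of "cis t" z] by simp
    have p: "norm (cis t - z) > 0" using assms(1) by auto
    have "(1 - norm z) / (1 + norm z) = (1 - (norm z)\<^sup>2) / (1 + norm z)\<^sup>2"
      using assms(1) norm_ge_zero[of z] by (simp add: divide_simps power2_eq_square) algebra
    also have "\<dots> \<le> (1 - (norm z)\<^sup>2) / (norm (cis t - z))\<^sup>2"
      using n p assms(1)
      by (intro divide_left_mono power_mono mult_pos_pos zero_less_power) (auto simp: power_le_one intro!: add_pos_nonneg)
    finally show "(1 - norm z) / (1 + norm z) \<le> Re ((cis t + z) / (cis t - z))"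
      by (simp only: Re_herglotz_kernel)
  qed
  also have "\<dots> = Re (LINT t:A|lborel. (cis t + z) / (cis t - z))"
    by (rule Re_set_integral[OF i, symmetric])
  finally show ?thesis .
qed

context slit_circle
begin

lemma ball_subset_\<Omega>: "norm z < 1 \<Longrightarrow> z \<in> \<Omega>"
  by (auto simp: \<Omega>_def)

lemma outside_subset_\<Omega>: "norm z > 1 \<Longrightarrow> z \<in> \<Omega>"
  by (auto simp: \<Omega>_def)

text \<open>Harnack's bound is applied to \<open>E\<close> for the first inequality and to its
  complement in \<open>{0..<2*pi}\<close> for the second. Both have positive measure because
  \<open>0 < \<alpha> < pi\<close>, and the full integral \<open>2 * pi\<close> becomes
  \<open>pi / 4\<close> after division by 8.\<close>

lemma Re_slit_potential_disc:
  assumes "norm z < 1"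
  shows "0 < Re (X z)" "Re (X z) < pi / 4"
proof -
  let ?k = "\<lambda>t. (cis t + z) / (cis t - z)"
  have q: "(1 - norm z) / (1 + norm z) > 0"
    using assms norm_ge_zero[of z] by (intro divide_pos_pos) linarith+
  have "0 < (1 - norm z) / (1 + norm z) * (2 * \<alpha>)"
    using q \<alpha>_pos by (intro mult_pos_pos) auto
  also have "\<dots> \<le> Re (LINT t:E|lborel. ?k t)"
    using Re_herglotz_integral_ge[OF assms E_borel bounded_E] E_measure by simp
  finally show "0 < Re (X z)"
    by (simp add: slit_potential_def)
  let ?A = "{0..<2*pi} - E"
  have A: "?A \<in> sets borel" "bounded ?A"
    using E_borel bounded_subset[OF bounded_closed_interval[of 0 "2*pi"], of ?A] by auto
  have "measure lborel ?A = measure lborel {0..<2*pi} - measure lborel E"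
    using E_borel E_sub by (intro measure_Diff) auto
  hence "measure lborel ?A > 0"
    using E_measure \<alpha>_lt by simp
  hence "0 < (1 - norm z) / (1 + norm z) * measure lborel ?A"
    using q by (intro mult_pos_pos) auto
  also have "\<dots> \<le> Re (LINT t:?A|lborel. ?k t)"
    using Re_herglotz_integral_ge[OF assms A] by simp
  also have "(LINT t:?A|lborel. ?k t) = of_real (2 * pi) - (LINT t:E|lborel. ?k t)"
  proof -
    have "(LINT t:E \<union> ?A|lborel. ?k t) = (LINT t:E|lborel. ?k t) + (LINT t:?A|lborel. ?k t)"
      using herglotz_kernel_integrable_disc[OF assms] A E_borel bounded_E by (intro set_integral_Un) auto
    moreover have "E \<union> ?A = {0..<2*pi}" using E_sub by auto
    ultimately show ?thesis using herglotz_integral_circle[OF assms] by simp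
  qed
  finally show "Re (X z) < pi / 4"
    by (simp add: slit_potential_def)
qed

lemma Re_slit_potential_circle:
  assumes "norm z = 1" "z \<in> \<Omega>"
  shows "Re (X z) = 0"
proof -
  have "Re (LINT t:E|lborel. (cis t + z) / (cis t - z)) = (LINT t:E|lborel. Re ((cis t + z) / (cis t - z)))"
    by (rule Re_set_integral[OF kernel_integrable[OF assms(2)]])
  also have "\<dots> = 0"
    by (simp only: Re_herglotz_kernel assms) (simp add: set_lebesgue_integral_def)
  finally show ?thesis by (simp add: slit_potential_def)
qed

text \<open>The disc is settled, on the circle off \<open>E\<close> the real part vanishes, and
  reflection carries the bound to the exterior.\<close>

lemma Re_slit_potential_bound:
  assumes "z \<in> \<Omega>"
  shows "\<bar>Re (X z)\<bar> < pi / 4"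
proof -
  consider "norm z < 1" | "norm z = 1" | "norm z > 1" by linarith
  thus ?thesis
  proof cases
    case 3
    define w where "w = 1 / cnj z"
    have w: "norm w < 1" "w \<noteq> 0" "z = 1 / cnj w" using 3 by (auto simp: w_def norm_divide divide_simps)
    have "X z = - cnj (X w)"
      using slit_potential_reflect[OF ball_subset_\<Omega>[OF w(1)] w(2)] w(3) by simp
    thus ?thesis using Re_slit_potential_disc[OF w(1)] by simp
  qed (use Re_slit_potential_disc[of z] Re_slit_potential_circle[of z] assms in auto)
qed

end

section \<open>Maps from the slit sphere to the disc\<close>

text \<open>The imaginary part contributes the same term as for the cosine, so comparing the two
  moduli reduces to comparing real parts.\<close>

lemma norm_sin_squared':
  fixes z :: complex
  shows "(norm (sin z))\<^sup>2 = (sin (Re z))\<^sup>2 + (exp (Im z) - inverse (exp (Im z)))\<^sup>2 / 4"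
proof -
  have "sin z = cos (of_real (pi / 2) - z)" by (simp add: sin_cos_eq)
  hence "(norm (sin z))\<^sup>2 = (norm (cos (of_real (pi / 2) - z)))\<^sup>2" by simp
  also have "\<dots> = (sin (Re z))\<^sup>2 + (exp (Im z) - inverse (exp (Im z)))\<^sup>2 / 4"
    unfolding norm_cos_squared by (simp add: sin_cos_eq exp_minus power2_commute)
  finally show ?thesis .
qed

text \<open>The squared moduli differ by \<open>cos (2 * Re x) * cos (2 * y)\<close>, which is
  positive in the strip. This is why the quotients defining \<open>\<phi>_inf\<close> and
  \<open>\<phi>_0\<close> map into the unit disc.\<close>

lemma norm_sin_less_norm_cos:
  fixes x :: complex and y :: real
  assumes "\<bar>Re x\<bar> < pi / 4" "\<bar>y\<bar> < pi / 4"
  shows "norm (sin (x + of_real y)) < norm (cos (x - of_real y))"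
proof -
  have "(cos (Re x - y))\<^sup>2 - (sin (Re x + y))\<^sup>2 = cos (2 * Re x) * cos (2 * y)"
  proof -
    have "(cos (Re x - y))\<^sup>2 - (sin (Re x + y))\<^sup>2
        = (cos (Re x) ^ 2 - sin (Re x) ^ 2) * (cos y ^ 2 - sin y ^ 2)"
      unfolding cos_diff sin_add by (simp add: algebra_simps power2_eq_square)
    thus ?thesis by (simp add: cos_double)
  qed
  moreover have "cos (2 * Re x) > 0" "cos (2 * y) > 0"
    using assms by (auto intro!: cos_gt_zero_pi)
  ultimately have "(sin (Re x + y))\<^sup>2 < (cos (Re x - y))\<^sup>2"
    by (smt (verit) mult_pos_pos)
  hence "(norm (sin (x + of_real y)))\<^sup>2 < (norm (cos (x - of_real y)))\<^sup>2"
    unfolding norm_sin_squared' norm_cos_squared by simp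
  thus ?thesis by (rule power2_less_imp_less) simp
qed

context slit_circle
begin

text \<open>\<open>X\<close> maps into the strip \<open>\<bar>Re\<bar> < \<pi> / 4\<close>, with \<open>X 0 = \<alpha> / 4\<close> and \<open>X \<infinity> = - \<alpha> / 4\<close>. Composing it with the
  conformal maps of the strip onto the unit disc that vanish at these two values gives \<open>\<phi>_0\<close> and
  \<open>\<phi>_inf\<close>.\<close>

definition \<phi>_inf :: "complex \<Rightarrow> complex" where
  "\<phi>_inf z = sin (X z + of_real (\<alpha> / 4)) / cos (X z - of_real (\<alpha> / 4))"

definition \<phi>_0 :: "complex \<Rightarrow> complex" where
  "\<phi>_0 z = sin (X z - of_real (\<alpha> / 4)) / cos (X z + of_real (\<alpha> / 4))"

lemma cos_slit_potential_nonzero: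
  assumes "z \<in> \<Omega>"
  shows "cos (X z - of_real (\<alpha> / 4)) \<noteq> 0" "cos (X z + of_real (\<alpha> / 4)) \<noteq> 0"
proof -
  show "cos (X z - of_real (\<alpha> / 4)) \<noteq> 0"
    using norm_sin_less_norm_cos[of "X z" "\<alpha> / 4"] Re_slit_potential_bound[OF assms] \<alpha>_pos \<alpha>_lt
    by auto
  show "cos (X z + of_real (\<alpha> / 4)) \<noteq> 0"
    using norm_sin_less_norm_cos[of "X z" "- \<alpha> / 4"] Re_slit_potential_bound[OF assms] \<alpha>_pos \<alpha>_lt
    by auto
qed

lemma \<phi>_holomorphic: "\<phi>_inf holomorphic_on \<Omega>" "\<phi>_0 holomorphic_on \<Omega>"
  unfolding \<phi>_inf_def \<phi>_0_def
  using cos_slit_potential_nonzero by (auto intro!: holomorphic_intros slit_potential_holomorphic)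

lemma norm_\<phi>_less_1:
  assumes "z \<in> \<Omega>"
  shows "norm (\<phi>_inf z) < 1" "norm (\<phi>_0 z) < 1"
proof -
  show "norm (\<phi>_inf z) < 1"
    using norm_sin_less_norm_cos[of "X z" "\<alpha> / 4"] Re_slit_potential_bound[OF assms] \<alpha>_pos \<alpha>_lt
      cos_slit_potential_nonzero[OF assms]
    by (simp add: \<phi>_inf_def norm_divide)
  show "norm (\<phi>_0 z) < 1"
    using norm_sin_less_norm_cos[of "X z" "- \<alpha> / 4"] Re_slit_potential_bound[OF assms] \<alpha>_pos \<alpha>_lt
      cos_slit_potential_nonzero[OF assms]
    by (simp add: \<phi>_0_def norm_divide)
qed

lemma \<phi>_inf_at_0: "\<phi>_inf 0 = of_real (sin (\<alpha> / 2))"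
  by (simp add: \<phi>_inf_def slit_potential_0 flip: of_real_add sin_of_real)

lemma \<phi>_0_at_0: "\<phi>_0 0 = 0"
  by (simp add: \<phi>_0_def slit_potential_0)

text \<open>Reflection replaces \<open>X z\<close> by \<open>- cnj (X z)\<close>; since the sine is
  odd and the cosine even, the two maps are exchanged up to sign and conjugation. This transfers
  facts between the disc and its exterior.\<close>

lemma \<phi>_inf_reflect:
  assumes "z \<in> \<Omega>" "z \<noteq> 0"
  shows "\<phi>_inf (1 / cnj z) = - cnj (\<phi>_0 z)"
proof -
  have "\<phi>_inf (1 / cnj z) = sin (- (cnj (X z - of_real (\<alpha> / 4)))) / cos (- (cnj (X z + of_real (\<alpha> / 4))))"
    by (simp add: \<phi>_inf_def slit_potential_reflect[OF assms] algebra_simps)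
  also have "\<dots> = - cnj (\<phi>_0 z)"
    by (simp only: \<phi>_0_def sin_minus cos_minus complex_cnj_divide cnj_sin cnj_cos) simp
  finally show ?thesis .
qed

lemma norm_\<phi>_0_le:
  assumes "norm z < 1"
  shows "norm (\<phi>_0 z) \<le> norm z"
proof (rule Schwarz_Lemma(1)[where f = \<phi>_0 and \<xi> = z])
  show "\<phi>_0 holomorphic_on ball 0 1"
    using \<phi>_holomorphic(2) by (rule holomorphic_on_subset) (auto intro: ball_subset_\<Omega>)
qed (use assms in \<open>auto intro: norm_\<phi>_less_1 ball_subset_\<Omega> \<phi>_0_at_0\<close>)

lemma norm_\<phi>_inf_le:
  assumes "norm z > 1"
  shows "norm (\<phi>_inf z) \<le> 1 / norm z"
proof -
  define w where "w = 1 / cnj z"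
  have w: "norm w < 1" "w \<noteq> 0" "z = 1 / cnj w" "norm w = 1 / norm z"
    using assms by (auto simp: w_def norm_divide divide_simps)
  have "norm (\<phi>_inf z) = norm (\<phi>_0 w)"
    using \<phi>_inf_reflect[OF ball_subset_\<Omega>[OF w(1)] w(2)] w(3) by simp
  thus ?thesis using norm_\<phi>_0_le[OF w(1)] w(4) by simp
qed

text \<open>The modulus is the \<open>n\<close>-th power of
  \<open>norm z * norm (\<phi>_inf z) * norm (\<phi>_inf z)\<close>: one factor
  \<open>\<phi>_inf\<close> compensates \<open>z\<close>, the other makes the inequality strict.
  Strictness is what settles the case of equality.\<close>

lemma norm_power_\<phi>_inf:
  assumes "z \<in> \<Omega>" "n \<ge> 1"
  shows "norm (z ^ n * \<phi>_inf z ^ (2 * n)) < 1"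
proof -
  have *: "norm (z ^ n * \<phi>_inf z ^ (2 * n)) = (norm z * norm (\<phi>_inf z) * norm (\<phi>_inf z)) ^ n"
    by (simp add: norm_mult norm_power power_mult_distrib power_mult power2_eq_square)
  have "norm z * norm (\<phi>_inf z) \<le> 1"
  proof (cases "norm z \<le> 1")
    case True
    thus ?thesis using norm_\<phi>_less_1(1)[OF assms(1)] mult_mono[of "norm z" 1 "norm (\<phi>_inf z)" 1] by simp
  next
    case False
    hence "norm z * norm (\<phi>_inf z) \<le> norm z * (1 / norm z)"
      using norm_\<phi>_inf_le[of z] by (intro mult_left_mono) auto
    also have "\<dots> = 1" using False by auto
    finally show ?thesis .
  qed
  hence "norm z * norm (\<phi>_inf z) * norm (\<phi>_inf z) \<le> norm (\<phi>_inf z)"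
    using mult_right_mono[of "norm z * norm (\<phi>_inf z)" 1 "norm (\<phi>_inf z)"] by simp
  also have "\<dots> < 1" by (rule norm_\<phi>_less_1(1)[OF assms(1)])
  finally show ?thesis
    using assms(2) unfolding * by (subst power_less_one_iff) auto
qed

text \<open>The parts of \<open>\<Omega>\<close> in the closed disc and in the closed exterior each
  lie between a connected open set and its closure. They share a point \<open>cis s\<close> of the
  circle, which exists because \<open>E\<close> does not have full measure.\<close>

lemma connected_\<Omega>: "connected \<Omega>"
proof -
  let ?B = "ball (0::complex) 1" and ?O = "- cball (0::complex) 1"
  have "measure lborel {0..<2*pi} \<noteq> measure lborel E" using E_measure \<alpha>_lt by simp
  hence "E \<noteq> {0..<2*pi}" by blast
  then obtain s where s: "s \<in> {0..<2*pi}" "s \<notin> E" using E_sub by blast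
  have inj: "cis s \<noteq> cis t" if "t \<in> E" for t
    using that s E_sub inj_onD[OF cis_inj_on, of s t] by blast
  have s\<Omega>: "cis s \<in> \<Omega>" using inj by (auto simp: \<Omega>_def)
  have 1: "connected (\<Omega> \<inter> cball 0 1)"
    by (rule connected_intermediate_closure[of ?B]) (auto simp: ball_subset_\<Omega>)
  have "connected ?O"
    by (rule connected_complement_bounded_convex) (simp_all add: bounded_cball)
  hence 2: "connected (\<Omega> \<inter> - ball 0 1)"
  proof (rule connected_intermediate_closure)
    show "?O \<subseteq> \<Omega> \<inter> - ball 0 1"
      using outside_subset_\<Omega> by (auto simp: not_le)
    show "\<Omega> \<inter> - ball 0 1 \<subseteq> closure ?O"
      by (simp add: closure_complement)
  qed
  have "cis s \<in> (\<Omega> \<inter> cball 0 1) \<inter> (\<Omega> \<inter> - ball 0 1)"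
    using s\<Omega> by simp
  hence "connected ((\<Omega> \<inter> cball 0 1) \<union> (\<Omega> \<inter> - ball 0 1))"
    by (intro connected_Un[OF 1 2]) blast
  moreover have "(\<Omega> \<inter> cball 0 1) \<union> (\<Omega> \<inter> - ball 0 1) = \<Omega>"
    by (auto simp: not_less)
  ultimately show ?thesis by (simp only:)
qed

end

section \<open>The maximum principle and the Joukowski map\<close>

text \<open>If \<open>norm (f z) > 1\<close>, the conditions at the frontier and at infinity make
  the set \<open>S\<close> where \<open>f\<close> is at least that large compact, so the maximum is
  attained. The points of maximum then form a compact set that is open by the local maximum
  principle, which is impossible for a nonempty subset of the plane.\<close>

lemma maximum_modulus_frontier:
  assumes D: "open D" and hol: "f holomorphic_on D"
    and bdry: "\<And>p e. p \<notin> D \<Longrightarrow> e > 0 \<Longrightarrow> \<forall>\<^sub>F z in at p within D. norm (f z) < 1 + e"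
    and infty: "\<And>e. e > 0 \<Longrightarrow> \<exists>R. \<forall>z\<in>D. norm z \<ge> R \<longrightarrow> norm (f z) < 1 + e"
    and "z \<in> D"
  shows "norm (f z) \<le> 1"
proof (rule ccontr)
  assume "\<not> norm (f z) \<le> 1"
  define e where "e = norm (f z) - 1"
  have e: "e > 0" using \<open>\<not> norm (f z) \<le> 1\<close> by (simp add: e_def)
  define S where "S = {u \<in> D. norm (f u) \<ge> 1 + e}"
  have cont: "continuous_on D f" using hol by (rule holomorphic_on_imp_continuous_on)
  have zS: "z \<in> S" using assms(5) by (simp add: S_def e_def)
  have "closed S"
    unfolding closed_limpt
  proof (intro allI impI)
    fix p assume lim: "p islimpt S"
    have "p \<in> D"
    proof (rule ccontr)
      assume "p \<notin> D"
      from bdry[OF this e] obtain d where d: "d > 0"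
        "\<And>u. u \<in> D \<Longrightarrow> u \<noteq> p \<Longrightarrow> dist u p < d \<Longrightarrow> norm (f u) < 1 + e"
        by (auto simp: eventually_at)
      obtain u where "u \<in> S" "u \<noteq> p" "dist u p < d"
        using lim d(1) by (auto simp: islimpt_approachable)
      with d(2)[of u] show False by (simp add: S_def)
    qed
    show "p \<in> S"
    proof (rule ccontr)
      assume "p \<notin> S"
      hence "norm (f p) < 1 + e" using \<open>p \<in> D\<close> by (simp add: S_def)
      moreover have "((\<lambda>u. norm (f u)) \<longlongrightarrow> norm (f p)) (at p)"
        using cont D \<open>p \<in> D\<close> by (intro tendsto_intros) (auto simp: continuous_on_eq_continuous_at isCont_def)
      ultimately have "\<forall>\<^sub>F u in at p. norm (f u) < 1 + e" by (rule order_tendstoD(2)[rotated])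
      then obtain d where d: "d > 0" "\<And>u. u \<noteq> p \<Longrightarrow> dist u p < d \<Longrightarrow> norm (f u) < 1 + e"
        by (auto simp: eventually_at)
      obtain u where "u \<in> S" "u \<noteq> p" "dist u p < d"
        using lim d(1) by (auto simp: islimpt_approachable)
      with d(2)[of u] show False by (simp add: S_def)
    qed
  qed
  moreover have "bounded S"
  proof -
    obtain R where "\<forall>u\<in>D. norm u \<ge> R \<longrightarrow> norm (f u) < 1 + e" using infty[OF e] by blast
    hence "S \<subseteq> cball 0 R" by (force simp: S_def)
    thus ?thesis using bounded_cball bounded_subset by blast
  qed
  ultimately have "compact S" by (simp add: compact_eq_bounded_closed)
  moreover have contS: "continuous_on S (\<lambda>u. norm (f u))"
    by (intro continuous_intros continuous_on_subset[OF cont]) (auto simp: S_def)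
  ultimately obtain m where m: "m \<in> S" "\<And>u. u \<in> S \<Longrightarrow> norm (f u) \<le> norm (f m)"
    using continuous_attains_sup[of S] zS by blast
  have max: "norm (f u) \<le> norm (f m)" if "u \<in> D" for u
    using m that by (cases "u \<in> S") (auto simp: S_def)
  define A where "A = {u \<in> S. norm (f u) = norm (f m)}"
  have "compact A"
  proof -
    have "A = S \<inter> (\<lambda>u. norm (f u)) -` {norm (f m)}" by (auto simp: A_def)
    moreover have "closedin (top_of_set S) (S \<inter> (\<lambda>u. norm (f u)) -` {norm (f m)})"
      by (rule continuous_closedin_preimage[OF contS]) auto
    ultimately show ?thesis using \<open>compact S\<close> closedin_compact by metis
  qed
  moreover have "open A"
    unfolding open_contains_ball
  proof
    fix p assume p: "p \<in> A"
    hence "p \<in> D" by (auto simp: A_def S_def)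
    then obtain r where r: "r > 0" "ball p r \<subseteq> D" using D open_contains_ball by blast
    have "f constant_on ball p r"
      by (rule maximum_modulus_principle[where U = "ball p r" and \<xi> = p])
         (use r p max hol in \<open>auto simp: A_def intro: holomorphic_on_subset\<close>)
    then obtain c where c: "\<And>u. u \<in> ball p r \<Longrightarrow> f u = c"
      by (auto simp: constant_on_def)
    have "ball p r \<subseteq> A"
    proof
      fix u assume u: "u \<in> ball p r"
      have "f u = f p" using c[OF u] c[of p] r(1) by simp
      thus "u \<in> A" using p u r(2) by (auto simp: A_def S_def)
    qed
    thus "\<exists>e>0. ball p e \<subseteq> A" using r(1) by blast
  qed
  ultimately have "A = {} \<or> A = UNIV"
    using clopen compact_imp_closed by blast
  moreover have "m \<in> A" using m by (simp add: A_def)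
  moreover have "A \<noteq> UNIV"
    using \<open>compact A\<close> compact_imp_bounded not_bounded_UNIV by metis
  ultimately show False by blast
qed

section \<open>The inverse Joukowski map\<close>

text \<open>The point \<open>w\<close> lies on an ellipse with foci 1 and -1 whose semi-major axis
  is \<open>s = (norm J + 1 / norm J) / 2\<close>. Hence \<open>norm J\<close> is one of the two
  roots \<open>s - sqrt (s\<^sup>2 - 1)\<close> and \<open>s + sqrt (s\<^sup>2 - 1)\<close>.\<close>

lemma joukowski_norm_le:
  fixes w J :: complex
  assumes "J \<noteq> 0" "2 * w = J + 1 / J"
  defines "s \<equiv> (norm (w - 1) + norm (w + 1)) / 2"
  shows "norm J \<le> s + sqrt (s\<^sup>2 - 1)"
proof -
  define b where "b = norm J"
  have b: "b > 0" using assms(1) by (simp add: b_def)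
  have "w - 1 = (J - 1)\<^sup>2 / (2 * J)" "w + 1 = (J + 1)\<^sup>2 / (2 * J)"
    using assms(1,2) by (simp_all add: field_simps power2_eq_square)
  hence "norm (w - 1) = (norm (J - 1))\<^sup>2 / (2 * b)" "norm (w + 1) = (norm (J + 1))\<^sup>2 / (2 * b)"
    by (simp_all add: norm_divide norm_mult norm_power b_def)
  moreover have "(norm (J - 1))\<^sup>2 + (norm (J + 1))\<^sup>2 = 2 * b\<^sup>2 + 2"
    unfolding b_def cmod_power2 by (simp add: power2_eq_square algebra_simps)
  ultimately have "s = (2 * b\<^sup>2 + 2) / (2 * b) / 2"
    by (simp add: s_def flip: add_divide_distrib)
  hence s: "2 * s * b = b\<^sup>2 + 1" using b by (simp add: field_simps power2_eq_square)
  have "(b - s)\<^sup>2 = s\<^sup>2 - 1" using s by (simp add: power2_eq_square algebra_simps)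
  hence "sqrt (s\<^sup>2 - 1) = \<bar>b - s\<bar>" by (metis real_sqrt_abs)
  thus ?thesis by (simp add: b_def)
qed

text \<open>The larger modulus among the two solutions \<open>J\<close> of
  \<open>2 * w = J + 1 / J\<close>. It is continuous across the slit [-1, 1], where
  \<open>jouk\<close> itself jumps, so it serves for boundary values.\<close>

definition jouk_bound :: "complex \<Rightarrow> real" where
  "jouk_bound w = (let s = (norm (w - 1) + norm (w + 1)) / 2 in s + sqrt (s\<^sup>2 - 1))"

lemma jouk_bound_continuous: "continuous_on UNIV jouk_bound"
  unfolding jouk_bound_def Let_def by (intro continuous_intros) auto

lemma jouk_bound_real:
  assumes "w = of_real x" "\<bar>x\<bar> \<le> 1"
  shows "jouk_bound w = 1"
proof -
  have "norm (w - 1) = 1 - x" "norm (w + 1) = 1 + x"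
    using assms norm_of_real[of "x - 1", where 'a = complex] norm_of_real[of "x + 1", where 'a = complex]
    by (auto simp: abs_if)
  thus ?thesis by (simp add: jouk_bound_def)
qed

lemma jouk_bound_le: "jouk_bound w \<le> 2 * (norm w + 1)"
proof -
  define s where "s = (norm (w - 1) + norm (w + 1)) / 2"
  have s: "0 \<le> s" "s \<le> norm w + 1"
    using norm_triangle_ineq[of w 1] norm_triangle_ineq4[of w 1] by (auto simp: s_def)
  have "sqrt (s\<^sup>2 - 1) \<le> sqrt (s\<^sup>2)" by (rule real_sqrt_le_mono) simp
  hence "sqrt (s\<^sup>2 - 1) \<le> s" using s by simp
  thus ?thesis using s by (simp add: jouk_bound_def s_def[symmetric])
qed

text \<open>The inverse Joukowski map off [-1, 1]. The form with \<open>1 / w\<^sup>2\<close> makes the principal root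
  holomorphic and single-valued on the complement of the slit.\<close>

definition jouk :: "complex \<Rightarrow> complex" where
  "jouk w = w * (1 + csqrt (1 - 1 / w\<^sup>2))"

text \<open>With \<open>c\<close> the square root, \<open>w * (1 + c)\<close> and
  \<open>w * (1 - c)\<close> have product \<open>w\<^sup>2 * (1 - c\<^sup>2) = 1\<close> and sum
  \<open>2 * w\<close>.\<close>

lemma jouk_eq:
  assumes "w \<noteq> 0"
  shows "jouk w \<noteq> 0" "2 * w = jouk w + 1 / jouk w"
proof -
  define c where "c = csqrt (1 - 1 / w\<^sup>2)"
  have c: "c\<^sup>2 = 1 - 1 / w\<^sup>2" by (simp add: c_def)
  have p: "jouk w * (w * (1 - c)) = 1"
  proof -
    have "jouk w * (w * (1 - c)) = w\<^sup>2 * (1 - c\<^sup>2)"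
      unfolding jouk_def c_def[symmetric] by (simp add: power2_eq_square algebra_simps)
    thus ?thesis using assms by (simp add: c)
  qed
  thus nz: "jouk w \<noteq> 0" by auto
  have "1 / jouk w = w * (1 - c)" using p nz by (simp add: field_simps)
  thus "2 * w = jouk w + 1 / jouk w" by (simp add: jouk_def c_def[symmetric] algebra_simps)
qed

lemma norm_jouk_le: "norm (jouk w) \<le> jouk_bound w"
proof (cases "w = 0")
  case True
  thus ?thesis by (simp add: jouk_def jouk_bound_def)
next
  case False
  from joukowski_norm_le[OF jouk_eq[OF this]] show ?thesis
    by (simp add: jouk_bound_def Let_def)
qed

definition off_slit :: "complex \<Rightarrow> bool" where
  "off_slit w \<longleftrightarrow> w \<noteq> 0 \<and> 1 - 1 / w\<^sup>2 \<notin> \<real>\<^sub>\<le>\<^sub>0"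

text \<open>For \<open>w \<noteq> 0\<close>, the radicand is a real \<open>r \<le> 0\<close> exactly
  when \<open>w\<^sup>2 = 1 / (1 - r)\<close> lies in (0, 1]; so the branch cut of the root
  corresponds to the slit.\<close>

lemma off_slit_iff: "off_slit w \<longleftrightarrow> \<not> (\<exists>x::real. \<bar>x\<bar> \<le> 1 \<and> w = of_real x)"
proof (cases "w = 0")
  case True
  thus ?thesis by (auto simp: off_slit_def intro!: exI[of _ 0])
next
  case False
  have "1 - 1 / w\<^sup>2 \<in> \<real>\<^sub>\<le>\<^sub>0 \<longleftrightarrow> (\<exists>x::real. \<bar>x\<bar> \<le> 1 \<and> w = of_real x)"
  proof
    assume "1 - 1 / w\<^sup>2 \<in> \<real>\<^sub>\<le>\<^sub>0"
    then obtain r where r: "1 - 1 / w\<^sup>2 = of_real r" "r \<le> 0" by (auto simp: nonpos_Reals_def)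
    have "1 / w\<^sup>2 = of_real (1 - r)" using r(1) by (simp add: algebra_simps)
    hence "w\<^sup>2 = of_real (1 / (1 - r))" using False by (metis of_real_1 of_real_divide divide_divide_eq_right mult_1 div_by_1)
    also have "\<dots> = (of_real (sqrt (1 / (1 - r))))\<^sup>2"
      using r(2) by (simp flip: of_real_power)
    finally have "w = of_real (sqrt (1 / (1 - r))) \<or> w = - of_real (sqrt (1 / (1 - r)))"
      by (simp only: power2_eq_iff)
    moreover have "\<bar>sqrt (1 / (1 - r))\<bar> \<le> 1" using r(2) by (simp add: divide_simps)
    ultimately show "\<exists>x::real. \<bar>x\<bar> \<le> 1 \<and> w = of_real x"
      by (metis abs_minus_cancel of_real_minus)
  next
    assume "\<exists>x::real. \<bar>x\<bar> \<le> 1 \<and> w = of_real x"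
    then obtain x where x: "\<bar>x\<bar> \<le> 1" "w = of_real x" by blast
    have "x \<noteq> 0" using False x by auto
    have "1 - 1 / w\<^sup>2 = of_real (1 - 1 / x\<^sup>2)" by (simp add: x)
    moreover have "1 - 1 / x\<^sup>2 \<le> 0"
      using x(1) \<open>x \<noteq> 0\<close> by (simp add: divide_simps abs_square_le_1)
    ultimately show "1 - 1 / w\<^sup>2 \<in> \<real>\<^sub>\<le>\<^sub>0"
      by (simp only: nonpos_Reals_of_real_iff)
  qed
  thus ?thesis using False by (simp add: off_slit_def)
qed

lemma jouk_cnj:
  assumes "off_slit w"
  shows "jouk (cnj w) = cnj (jouk w)"
  using assms cnj_csqrt[of "1 - 1 / w\<^sup>2"] by (simp add: jouk_def off_slit_def)

lemma jouk_real:
  assumes "\<bar>x\<bar> > 1"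
  shows "jouk (of_real x) \<in> \<real>"
proof -
  have "1 / x\<^sup>2 \<le> 1" using assms by (simp add: divide_simps) (metis abs_le_square_iff abs_one less_imp_le one_power2)
  hence "csqrt (1 - 1 / (of_real x)\<^sup>2) = of_real (sqrt (1 - 1 / x\<^sup>2))"
    using of_real_sqrt[of "1 - 1 / x\<^sup>2"] by simp
  thus ?thesis by (simp add: jouk_def)
qed

section \<open>Self-reciprocal polynomials bounded on a circle set\<close>

text \<open>\<open>P_reflect\<close> makes \<open>P(z) / z^n\<close> real on the circle. The factor
  2 in \<open>P_bound\<close> goes with the normalisation \<open>P_0\<close>, since
  \<open>cos (n * t)\<close> is half of \<open>cis (n * t) + cis (- n * t)\<close>.\<close>

locale slit_circle_poly = slit_circle +
  fixes P :: "complex poly" and n :: nat and M :: real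
  assumes n_pos: "n \<ge> 1" and M_pos: "M > 0"
    and degree_P: "degree P \<le> 2 * n"
    and P_0: "poly P 0 = 1"
    and P_reflect: "\<And>z. z \<noteq> 0 \<Longrightarrow> poly P (1 / cnj z) = cnj (poly P z) / cnj z ^ (2 * n)"
    and P_bound: "\<And>t. t \<in> E \<Longrightarrow> norm (poly P (cis t)) \<le> 2 * M"
begin

definition w :: "complex \<Rightarrow> complex" where
  "w z = poly P z / (2 * of_real M * z ^ n)"

definition u :: "complex \<Rightarrow> complex" where
  "u z = 2 * of_real M * z ^ n / poly P z"

text \<open>The points that \<open>w\<close> maps off the slit. Writing this with \<open>u\<close>,
  the reciprocal of \<open>w\<close>, includes 0, where \<open>w\<close> has a pole.\<close>

definition D :: "complex set" where
  "D = {z. poly P z \<noteq> 0 \<and> 1 - (u z)\<^sup>2 \<notin> \<real>\<^sub>\<le>\<^sub>0}"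

text \<open>\<open>G z = jouk (w z) * z ^ n * \<phi>_inf z ^ (2 * n)\<close>, written so that it makes sense at 0, where \<open>w\<close>
  has a pole.\<close>

definition G :: "complex \<Rightarrow> complex" where
  "G z = poly P z / (2 * of_real M) * (1 + csqrt (1 - (u z)\<^sup>2)) * \<phi>_inf z ^ (2 * n)"

lemma zero_in_D: "0 \<in> D"
  using n_pos P_0 by (simp add: D_def u_def zero_power)

lemma in_D_iff:
  assumes "z \<noteq> 0"
  shows "z \<in> D \<longleftrightarrow> off_slit (w z)"
proof -
  have "(u z)\<^sup>2 = 1 / (w z)\<^sup>2" if "poly P z \<noteq> 0"
    using that assms M_pos by (simp add: u_def w_def power_divide)
  moreover have "w z = 0 \<longleftrightarrow> poly P z = 0"
    using assms M_pos by (simp add: w_def)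
  ultimately show ?thesis by (auto simp: D_def off_slit_def)
qed

lemma w_reflect:
  assumes "z \<noteq> 0"
  shows "w (1 / cnj z) = cnj (w z)"
proof -
  have "cnj z ^ (2 * n) = cnj z ^ n * cnj z ^ n" by (simp add: mult_2 power_add)
  thus ?thesis using assms by (simp add: w_def P_reflect power_divide)
qed

lemma w_circle_real:
  assumes "norm z = 1"
  shows "w z = of_real (Re (w z))"
proof -
  have "z \<noteq> 0" using assms by auto
  have "1 / cnj z = z"
    using assms \<open>z \<noteq> 0\<close> complex_norm_square[of z] by (simp add: field_simps)
  hence "w z = cnj (w z)" using w_reflect[OF \<open>z \<noteq> 0\<close>] by simp
  thus ?thesis by (metis Reals_cnj_iff of_real_Re)
qed

lemma norm_w_circle:
  assumes "norm z = 1"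
  shows "\<bar>Re (w z)\<bar> = norm (poly P z) / (2 * M)"
proof -
  have "norm (w z) = \<bar>Re (w z)\<bar>" by (metis w_circle_real[OF assms] norm_of_real)
  thus ?thesis using assms M_pos by (simp add: w_def norm_divide norm_mult norm_power)
qed

text \<open>On \<open>E\<close> the bound on \<open>P\<close> puts the real number
  \<open>w z\<close> into [-1, 1], that is, on the slit.\<close>

lemma D_subset_\<Omega>: "D \<subseteq> \<Omega>"
proof
  fix z assume z: "z \<in> D"
  show "z \<in> \<Omega>"
  proof (rule ccontr)
    assume "z \<notin> \<Omega>"
    then obtain t where t: "t \<in> E" "z = cis t" by (auto simp: \<Omega>_def)
    have "\<bar>Re (w z)\<bar> \<le> 1"
      using norm_w_circle[of z] P_bound[OF t(1)] t(2) M_pos by simp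
    hence "\<not> off_slit (w z)"
      using w_circle_real[of z] t(2) unfolding off_slit_iff by auto
    thus False using in_D_iff[of z] z t(2) by simp
  qed
qed

lemma u_holomorphic: "u holomorphic_on {z. poly P z \<noteq> 0}"
  unfolding u_def by (intro holomorphic_intros) auto

lemma open_D: "open D"
proof -
  have o: "open {z. poly P z \<noteq> 0}"
    by (intro open_Collect_neq continuous_intros)
  have "open ({z. poly P z \<noteq> 0} \<inter> (\<lambda>z. 1 - (u z)\<^sup>2) -` (- \<real>\<^sub>\<le>\<^sub>0))"
    using holomorphic_on_imp_continuous_on[OF u_holomorphic] o
    by (intro continuous_open_preimage continuous_intros) (auto simp: closed_nonpos_Reals_complex)
  also have "{z. poly P z \<noteq> 0} \<inter> (\<lambda>z. 1 - (u z)\<^sup>2) -` (- \<real>\<^sub>\<le>\<^sub>0) = D"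
    by (auto simp: D_def)
  finally show ?thesis .
qed

lemma G_holomorphic: "G holomorphic_on D"
  unfolding G_def
  by (intro holomorphic_intros holomorphic_on_subset[OF u_holomorphic]
       holomorphic_on_subset[OF \<phi>_holomorphic(1) D_subset_\<Omega>])
     (use M_pos in \<open>auto simp: D_def\<close>)

lemma G_eq_jouk:
  assumes "z \<in> D" "z \<noteq> 0"
  shows "G z = jouk (w z) * (z ^ n * \<phi>_inf z ^ (2 * n))"
proof -
  have "(u z)\<^sup>2 = 1 / (w z)\<^sup>2"
    using assms M_pos by (simp add: D_def u_def w_def power_divide)
  moreover have "poly P z / (2 * of_real M) = w z * z ^ n"
    using assms by (simp add: w_def)
  ultimately show ?thesis
    unfolding G_def jouk_def by simp
qed

lemma norm_G_le:
  assumes "z \<in> D" "z \<noteq> 0"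
  shows "norm (G z) \<le> jouk_bound (w z) * norm (z ^ n * \<phi>_inf z ^ (2 * n))"
  using mult_right_mono[OF norm_jouk_le norm_ge_zero]
  by (simp only: G_eq_jouk[OF assms] norm_mult[of "jouk (w z)"])

lemma jouk_bound_nonneg: "jouk_bound v \<ge> 0"
  using norm_jouk_le[of v] norm_ge_zero[of "jouk v"] by linarith

lemma norm_G_le':
  assumes "z \<in> D" "z \<noteq> 0"
  shows "norm (G z) \<le> jouk_bound (w z)"
proof -
  have "norm (z ^ n * \<phi>_inf z ^ (2 * n)) \<le> 1"
    using norm_power_\<phi>_inf[of z n] n_pos assms(1) D_subset_\<Omega> by fastforce
  hence "jouk_bound (w z) * norm (z ^ n * \<phi>_inf z ^ (2 * n)) \<le> jouk_bound (w z) * 1"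
    by (intro mult_left_mono jouk_bound_nonneg)
  thus ?thesis using norm_G_le[OF assms] by linarith
qed

lemma jouk_bound_w_tendsto:
  assumes "p \<noteq> 0"
  shows "((\<lambda>z. jouk_bound (w z)) \<longlongrightarrow> jouk_bound (w p)) (at p within S)"
proof -
  have "(w \<longlongrightarrow> w p) (at p within S)"
    unfolding w_def using assms M_pos by (intro tendsto_intros) auto
  thus ?thesis
    by (rule continuous_on_tendsto_compose[OF jouk_bound_continuous]) auto
qed

lemma jouk_bound_w_off_D:
  assumes "p \<notin> D"
  shows "p \<noteq> 0" "jouk_bound (w p) = 1"
proof -
  show "p \<noteq> 0" using assms zero_in_D by auto
  thus "jouk_bound (w p) = 1"
    using assms jouk_bound_real by (auto simp: in_D_iff off_slit_iff)
qed

lemma norm_poly_le: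
  assumes "norm z \<ge> 1"
  shows "norm (poly P z) \<le> (\<Sum>i\<le>degree P. norm (coeff P i)) * norm z ^ (2 * n)"
proof -
  have "norm (poly P z) \<le> (\<Sum>i\<le>degree P. norm (coeff P i * z ^ i))"
    unfolding poly_altdef by (rule norm_sum)
  also have "\<dots> \<le> (\<Sum>i\<le>degree P. norm (coeff P i) * norm z ^ (2 * n))"
    using assms degree_P
    by (intro sum_mono) (auto simp: norm_mult norm_power intro!: mult_left_mono power_increasing)
  finally show ?thesis by (simp add: sum_distrib_right)
qed

text \<open>With \<open>r = norm z ^ n\<close>, the factor \<open>jouk (w z)\<close> grows at most
  like \<open>r\<close>, while \<open>z ^ n * \<phi>_inf z ^ (2 * n)\<close> is at most
  \<open>1 / r\<close>.\<close>

lemma norm_G_bounded_outside: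
  obtains B where "\<And>z. z \<in> D \<Longrightarrow> norm z > 1 \<Longrightarrow> norm (G z) \<le> B"
proof
  fix z assume z: "z \<in> D" "norm z > 1"
  define C where "C = (\<Sum>i\<le>degree P. norm (coeff P i))"
  define r where "r = norm z ^ n"
  have r: "r \<ge> 1" using z(2) by (simp add: r_def)
  have r2: "norm z ^ (2 * n) = r * r" by (simp add: r_def mult_2 power_add)
  have "norm (w z) = norm (poly P z) / (2 * M * r)"
    using M_pos by (simp add: w_def norm_divide norm_mult norm_power r_def)
  also have "\<dots> \<le> C * (r * r) / (2 * M * r)"
    using norm_poly_le[of z] z(2) M_pos r unfolding C_def r2 by (intro divide_right_mono) auto
  also have "\<dots> = C / (2 * M) * r"
    using r M_pos by (simp add: field_simps)
  finally have wz: "norm (w z) \<le> C / (2 * M) * r" .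
  have "norm (z ^ n * \<phi>_inf z ^ (2 * n)) \<le> r * (1 / norm z) ^ (2 * n)"
    using norm_\<phi>_inf_le[OF z(2)] unfolding r_def norm_mult norm_power
    by (intro mult_left_mono power_mono) auto
  also have "\<dots> = 1 / r"
    using r unfolding power_divide r2 by simp
  finally have p: "norm (z ^ n * \<phi>_inf z ^ (2 * n)) \<le> 1 / r" .
  have "2 * (norm (w z) + 1) \<le> 2 * (C / (2 * M) * r + r)"
    using wz r by (intro mult_left_mono add_mono) auto
  with jouk_bound_le have j: "jouk_bound (w z) \<le> 2 * (C / (2 * M) * r + r)"
    by (rule order_trans)
  have "norm (G z) \<le> jouk_bound (w z) * norm (z ^ n * \<phi>_inf z ^ (2 * n))"
    using z by (intro norm_G_le) auto
  also have "\<dots> \<le> (2 * (C / (2 * M) * r + r)) * (1 / r)"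
    by (rule mult_mono[OF j p order_trans[OF jouk_bound_nonneg j] norm_ge_zero])
  also have "\<dots> = 2 * (C / (2 * M) + 1)"
    using r by (simp add: field_simps)
  finally show "norm (G z) \<le> 2 * ((\<Sum>i\<le>degree P. norm (coeff P i)) / (2 * M) + 1)"
    by (simp add: C_def)
qed

text \<open>At infinity \<open>G\<close> is merely bounded; the extra factor \<open>\<phi>_inf\<close> makes the product vanish there.\<close>

lemma norm_\<phi>_G_power_le:
  assumes "z \<in> D"
  shows "norm (\<phi>_inf z * G z ^ k) \<le> 1"
proof (rule maximum_modulus_frontier[OF open_D _ _ _ assms])
  show "(\<lambda>z. \<phi>_inf z * G z ^ k) holomorphic_on D"
    by (intro holomorphic_intros G_holomorphic holomorphic_on_subset[OF \<phi>_holomorphic(1) D_subset_\<Omega>])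
next
  fix p and e :: real assume p: "p \<notin> D" and e: "e > 0"
  have "((\<lambda>z. jouk_bound (w z) ^ k) \<longlongrightarrow> jouk_bound (w p) ^ k) (at p within D)"
    by (intro tendsto_intros jouk_bound_w_tendsto jouk_bound_w_off_D(1)[OF p])
  hence "\<forall>\<^sub>F z in at p within D. jouk_bound (w z) ^ k < 1 + e"
    by (rule order_tendstoD(2)) (use e in \<open>simp add: jouk_bound_w_off_D[OF p]\<close>)
  moreover have "\<forall>\<^sub>F z in at p within D. z \<in> D" by (simp add: eventually_at_filter)
  moreover have "\<forall>\<^sub>F z in at p within D. z \<noteq> 0"
    using tendsto_imp_eventually_ne[OF tendsto_ident_at jouk_bound_w_off_D(1)[OF p]] .
  ultimately show "\<forall>\<^sub>F z in at p within D. norm (\<phi>_inf z * G z ^ k) < 1 + e"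
  proof eventually_elim
    case (elim z)
    have "norm (\<phi>_inf z * G z ^ k) = norm (\<phi>_inf z) * norm (G z) ^ k"
      by (simp add: norm_mult norm_power)
    also have "\<dots> \<le> 1 * jouk_bound (w z) ^ k"
      using norm_\<phi>_less_1(1)[of z] elim D_subset_\<Omega> norm_G_le'[of z]
      by (intro mult_mono power_mono) auto
    finally show ?case using elim by simp
  qed
next
  fix e :: real assume e: "e > 0"
  obtain B where B: "\<And>z. z \<in> D \<Longrightarrow> norm z > 1 \<Longrightarrow> norm (G z) \<le> B"
    using norm_G_bounded_outside by blast
  \<comment> \<open>\<open>\<bar>B\<bar> ^ k\<close> absorbs the bound on \<open>G ^ k\<close>
    against \<open>norm (\<phi>_inf z) \<le> 1 / norm z\<close>; the 2 keeps \<open>z\<close>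
    outside the closed disc.\<close>
  define R where "R = max 2 (\<bar>B\<bar> ^ k)"
  have "norm (\<phi>_inf z * G z ^ k) < 1 + e" if z: "z \<in> D" "norm z \<ge> R" for z
  proof -
    have z1: "norm z > 1" using z(2) by (simp add: R_def)
    have "norm (G z) \<le> \<bar>B\<bar>" using B[OF z(1) z1] by linarith
    hence "norm (\<phi>_inf z * G z ^ k) \<le> (1 / norm z) * \<bar>B\<bar> ^ k"
      unfolding norm_mult norm_power using norm_\<phi>_inf_le[OF z1]
      by (intro mult_mono power_mono) auto
    also have "\<dots> \<le> 1" using z(2) z1 by (simp add: R_def divide_simps)
    finally show ?thesis using e by simp
  qed
  thus "\<exists>R. \<forall>z\<in>D. norm z \<ge> R \<longrightarrow> norm (\<phi>_inf z * G z ^ k) < 1 + e" by blast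
qed

text \<open>If \<open>norm (G z) > 1\<close>, a high power of it outweighs the fixed factor
  \<open>\<phi>_inf z\<close>, which is nonzero because it divides \<open>G z\<close>.\<close>

lemma norm_G_le_1:
  assumes "z \<in> D"
  shows "norm (G z) \<le> 1"
proof (rule ccontr)
  assume g: "\<not> norm (G z) \<le> 1"
  have "\<phi>_inf z \<noteq> 0"
    using g n_pos by (auto simp: G_def zero_power)
  obtain k where "1 / norm (\<phi>_inf z) < norm (G z) ^ k"
    using real_arch_pow[of "norm (G z)"] g by auto
  hence "1 < norm (\<phi>_inf z * G z ^ k)"
    using \<open>\<phi>_inf z \<noteq> 0\<close> by (simp add: norm_mult norm_power field_simps)
  thus False using norm_\<phi>_G_power_le[OF assms, of k] by simp
qed

lemma G_at_0: "G 0 = of_real (sin (\<alpha> / 2) ^ (2 * n) / M)"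
  using n_pos P_0 by (simp add: G_def u_def \<phi>_inf_at_0 zero_power)

lemma deviation_ge: "M \<ge> sin (\<alpha> / 2) ^ (2 * n)"
proof -
  have "norm (G 0) = \<bar>sin (\<alpha> / 2) ^ (2 * n) / M\<bar>"
    unfolding G_at_0 by (rule norm_of_real)
  hence "sin (\<alpha> / 2) ^ (2 * n) / M \<le> 1"
    using norm_G_le_1[OF zero_in_D] by linarith
  thus ?thesis using M_pos by (simp add: field_simps)
qed

end

section \<open>The case of equality\<close>

locale slit_circle_extremal = slit_circle_poly +
  assumes M_eq: "M = sin (\<alpha> / 2) ^ (2 * n)"
begin

lemma G_at_0_extremal: "G 0 = 1"
  unfolding G_at_0 M_eq[symmetric] using M_pos by simp

lemma extremal_locally_1:
  assumes "p \<in> D" "G p = 1"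
  obtains r where "r > 0" "ball p r \<subseteq> D" "\<And>z. z \<in> ball p r \<Longrightarrow> G z = 1"
proof -
  obtain r where r: "r > 0" "ball p r \<subseteq> D" using open_D assms(1) open_contains_ball by blast
  have "G constant_on ball p r"
  proof (rule maximum_modulus_principle[where U = "ball p r" and \<xi> = p])
    show "norm (G z) \<le> norm (G p)" if "z \<in> ball p r" for z
      using norm_G_le_1[of z] r(2) that assms(2) by auto
  qed (use r holomorphic_on_subset[OF G_holomorphic] in auto)
  then obtain c where c: "\<And>z. z \<in> ball p r \<Longrightarrow> G z = c"
    by (auto simp: constant_on_def)
  have "c = 1" using c[of p] r(1) assms(2) by simp
  thus ?thesis using c r that by blast
qed

text \<open>At a limit point off \<open>D\<close> the boundary value of
  \<open>jouk_bound (w z)\<close> is 1 while the remaining factor is strictly below 1, so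
  \<open>G\<close> could not stay equal to 1 along the sequence.\<close>

lemma extremal_limit_in_D:
  assumes "p \<in> \<Omega>" and f: "f \<longlonglongrightarrow> p" "\<And>i. f i \<in> D" "\<And>i. G (f i) = 1"
  shows "p \<in> D"
proof (rule ccontr)
  assume p: "p \<notin> D"
  have "\<forall>\<^sub>F i in sequentially. f i \<noteq> 0"
    using tendsto_imp_eventually_ne[OF f(1) jouk_bound_w_off_D(1)[OF p]] .
  hence ev: "\<forall>\<^sub>F i in sequentially. 1 \<le> jouk_bound (w (f i)) * norm (f i ^ n * \<phi>_inf (f i) ^ (2 * n))"
  proof eventually_elim
    case (elim i)
    show ?case using norm_G_le[OF f(2)[of i] elim] f(3)[of i] by simp
  qed
  have "isCont (\<lambda>z. jouk_bound (w z)) p"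
    using jouk_bound_w_tendsto[OF jouk_bound_w_off_D(1)[OF p], of UNIV] by (simp add: isCont_def)
  hence 1: "(\<lambda>i. jouk_bound (w (f i))) \<longlonglongrightarrow> jouk_bound (w p)"
    using f(1) by (rule isCont_tendsto_compose)
  have "continuous_on \<Omega> \<phi>_inf"
    using \<phi>_holomorphic(1) by (rule holomorphic_on_imp_continuous_on)
  hence "(\<lambda>i. \<phi>_inf (f i)) \<longlonglongrightarrow> \<phi>_inf p"
    by (rule continuous_on_tendsto_compose)
       (use f(1,2) assms(1) D_subset_\<Omega> in \<open>auto intro!: always_eventually\<close>)
  hence "(\<lambda>i. jouk_bound (w (f i)) * norm (f i ^ n * \<phi>_inf (f i) ^ (2 * n))) \<longlonglongrightarrow>
      jouk_bound (w p) * norm (p ^ n * \<phi>_inf p ^ (2 * n))"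
    by (intro tendsto_intros 1 f(1))
  hence "1 \<le> jouk_bound (w p) * norm (p ^ n * \<phi>_inf p ^ (2 * n))"
    using ev by (rule tendsto_lowerbound) simp
  thus False
    using norm_power_\<phi>_inf[OF assms(1) n_pos] jouk_bound_w_off_D(2)[OF p] by simp
qed

text \<open>The set where \<open>G = 1\<close> is open by the maximum principle and closed in the
  connected set \<open>\<Omega>\<close>. In particular \<open>D\<close> is all of
  \<open>\<Omega>\<close>.\<close>

lemma extremal_everywhere:
  assumes "z \<in> \<Omega>"
  shows "z \<in> D" "G z = 1"
proof -
  define A where "A = {z \<in> D. G z = 1}"
  have "open A"
    unfolding open_contains_ball
  proof
    fix p assume "p \<in> A"
    then obtain r where "r > 0" "ball p r \<subseteq> D" "\<And>z. z \<in> ball p r \<Longrightarrow> G z = 1"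
      using extremal_locally_1[of p] by (auto simp: A_def)
    thus "\<exists>e>0. ball p e \<subseteq> A" by (auto simp: A_def)
  qed
  have sub: "A \<subseteq> \<Omega>" using D_subset_\<Omega> by (auto simp: A_def)
  have "openin (top_of_set \<Omega>) A"
    using \<open>open A\<close> sub open_\<Omega> by (simp add: openin_open_eq)
  moreover have "closedin (top_of_set \<Omega>) A"
    unfolding closedin_limpt
  proof (intro conjI sub allI impI)
    fix p assume "p islimpt A \<and> p \<in> \<Omega>"
    then obtain f where f: "\<And>i. f i \<in> A" "f \<longlonglongrightarrow> p" and p: "p \<in> \<Omega>"
      unfolding islimpt_sequential by auto
    have "p \<in> D" using extremal_limit_in_D[OF p f(2)] f(1) by (auto simp: A_def)
    moreover have "isCont G p"
      using holomorphic_on_imp_continuous_on[OF G_holomorphic] open_D \<open>p \<in> D\<close>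
      by (simp add: continuous_on_eq_continuous_at)
    hence "(\<lambda>i. G (f i)) \<longlonglongrightarrow> G p" using f(2) by (rule isCont_tendsto_compose)
    moreover have "(\<lambda>i. G (f i)) = (\<lambda>_. 1)" using f(1) by (auto simp: A_def)
    ultimately show "p \<in> A" by (simp add: A_def LIMSEQ_const_iff)
  qed
  ultimately have "A = {} \<or> A = \<Omega>"
    using connected_\<Omega> unfolding connected_clopen by blast
  moreover have "0 \<in> A" using zero_in_D G_at_0_extremal by (simp add: A_def)
  ultimately have "A = \<Omega>" by blast
  thus "z \<in> D" "G z = 1" using assms by (auto simp: A_def)
qed

lemma extremal_jouk:
  assumes "z \<in> \<Omega>" "z \<noteq> 0"
  shows "jouk (w z) * (z ^ n * \<phi>_inf z ^ (2 * n)) = 1"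
  using extremal_everywhere[OF assms(1)] G_eq_jouk[of z] assms(2) by simp

lemma extremal_off_slit:
  assumes "z \<in> \<Omega>" "z \<noteq> 0"
  shows "off_slit (w z)"
  using extremal_everywhere[OF assms(1)] in_D_iff assms(2) by simp

lemma extremal_gt:
  assumes "cis t \<in> \<Omega>"
  shows "norm (poly P (cis t)) > 2 * M"
proof (rule ccontr)
  assume "\<not> norm (poly P (cis t)) > 2 * M"
  hence "\<bar>Re (w (cis t))\<bar> \<le> 1" using norm_w_circle[of "cis t"] M_pos by simp
  thus False
    using extremal_off_slit[OF assms] w_circle_real[of "cis t"] unfolding off_slit_iff by auto
qed

text \<open>Compare \<open>G = 1\<close> at \<open>z\<close> with \<open>G = 1\<close> at the mirror image \<open>1 / cnj z\<close>: reflection conjugates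
  \<open>jouk (w z)\<close> and exchanges \<open>\<phi>_inf\<close> with \<open>\<phi>_0\<close>.\<close>

lemma extremal_norm_\<phi>_0:
  assumes "norm z < 1"
  shows "norm (\<phi>_0 z) = norm z * norm (\<phi>_inf z)"
proof (cases "z = 0")
  case False
  have z: "z \<in> \<Omega>" using assms by (rule ball_subset_\<Omega>)
  define z' where "z' = 1 / cnj z"
  have z': "z' \<in> \<Omega>" "z' \<noteq> 0"
    using assms False by (auto intro!: outside_subset_\<Omega> simp: z'_def norm_divide divide_simps)
  have "jouk (cnj (w z)) * (z' ^ n * \<phi>_inf z' ^ (2 * n)) = 1"
    using extremal_jouk[OF z'] w_reflect[OF False] by (simp add: z'_def)
  hence "norm (jouk (w z)) * (norm z' ^ n * norm (\<phi>_0 z) ^ (2 * n)) = norm (1::complex)"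
    unfolding jouk_cnj[OF extremal_off_slit[OF z False]] z'_def \<phi>_inf_reflect[OF z False]
    by (metis complex_mod_cnj norm_minus_cancel norm_mult norm_power)
  moreover have "norm z' ^ n = 1 / norm z ^ n"
    by (simp add: z'_def norm_divide power_divide)
  ultimately have 1: "norm (jouk (w z)) * (1 / norm z ^ n * norm (\<phi>_0 z) ^ (2 * n)) = 1"
    by (simp only: norm_one)
  have "norm (jouk (w z) * (z ^ n * \<phi>_inf z ^ (2 * n))) = norm (1::complex)"
    using extremal_jouk[OF z False] by simp
  hence 2: "norm (jouk (w z)) * (norm z ^ n * norm (\<phi>_inf z) ^ (2 * n)) = 1"
    by (simp add: norm_mult norm_power)
  have j: "norm (jouk (w z)) \<noteq> 0" using 2 by auto
  \<comment> \<open>Equating the two identities and cancelling \<open>norm (jouk (w z))\<close>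
    gives an equality of \<open>2 * n\<close>-th powers of nonnegative numbers.\<close>
  have "norm (\<phi>_0 z) ^ (2 * n) = norm z ^ n * (1 / norm z ^ n * norm (\<phi>_0 z) ^ (2 * n))"
    using False by simp
  also have "1 / norm z ^ n * norm (\<phi>_0 z) ^ (2 * n) = norm z ^ n * norm (\<phi>_inf z) ^ (2 * n)"
    using 1 2 j by (metis mult_left_cancel)
  also have "norm z ^ n * (norm z ^ n * norm (\<phi>_inf z) ^ (2 * n)) = (norm z * norm (\<phi>_inf z)) ^ (2 * n)"
    by (simp add: power_mult_distrib mult_2 power_add)
  finally show ?thesis
    using n_pos by (subst (asm) power_eq_iff_eq_base) auto
qed (simp add: \<phi>_0_at_0)

lemma extremal_\<phi>_inf_nonzero:
  assumes "z \<in> \<Omega>"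
  shows "\<phi>_inf z \<noteq> 0"
  using extremal_everywhere(2)[OF assms] n_pos by (auto simp: G_def zero_power)

text \<open>The quotient preserves the modulus in the disc, so the equality case of the Schwarz
  lemma makes it a rotation there. Radial limits carry this to the points of the circle in
  \<open>\<Omega>\<close>.\<close>

lemma extremal_rotation:
  obtains c where "norm c = 1" "\<And>p. p \<in> \<Omega> \<Longrightarrow> norm p = 1 \<Longrightarrow> \<phi>_0 p / \<phi>_inf p = c * p"
proof -
  define q where "q z = \<phi>_0 z / \<phi>_inf z" for z
  have hol: "q holomorphic_on \<Omega>"
    unfolding q_def using extremal_\<phi>_inf_nonzero by (intro holomorphic_intros \<phi>_holomorphic)
  have nq: "norm (q z) = norm z" if "norm z < 1" for z
    using extremal_norm_\<phi>_0[OF that] extremal_\<phi>_inf_nonzero[OF ball_subset_\<Omega>[OF that]]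
    by (simp add: q_def norm_divide)
  have "\<exists>c. (\<forall>z. norm z < 1 \<longrightarrow> q z = c * z) \<and> norm c = 1"
  proof (rule Schwarz_Lemma(3)[where f = q and \<xi> = 0])
    show "q holomorphic_on ball 0 1"
      using hol by (rule holomorphic_on_subset) (auto intro: ball_subset_\<Omega>)
    show "(\<exists>z. norm z < 1 \<and> z \<noteq> 0 \<and> norm (q z) = norm z) \<or> norm (deriv q 0) = 1"
      using nq[of "1/2"] by (intro disjI1 exI[of _ "1/2"]) auto
    show "q 0 = 0" using nq[of 0] by simp
  qed (use nq in auto)
  then obtain c where c: "\<And>z. norm z < 1 \<Longrightarrow> q z = c * z" "norm c = 1" by blast
  have "q p = c * p" if p: "p \<in> \<Omega>" "norm p = 1" for p
  proof -
    define f where "f i = of_real (1 - inverse (real (Suc i))) * p" for i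
    have "f \<longlonglongrightarrow> of_real (1 - 0) * p"
      unfolding f_def by (intro tendsto_intros LIMSEQ_inverse_real_of_nat)
    hence f: "f \<longlonglongrightarrow> p" by simp
    have nf: "norm (f i) < 1" for i
    proof -
      have "norm (f i) = \<bar>1 - inverse (real (Suc i))\<bar>"
        by (simp only: f_def norm_mult norm_of_real p mult_1_right)
      moreover have "inverse (real (Suc i)) > 0" "inverse (real (Suc i)) \<le> 1"
        by (auto simp: field_simps)
      ultimately show ?thesis by linarith
    qed
    have "(\<lambda>i. q (f i)) \<longlonglongrightarrow> q p"
      by (rule continuous_on_tendsto_compose[OF holomorphic_on_imp_continuous_on[OF hol] f p(1)])
         (use nf ball_subset_\<Omega> in auto)
    moreover have "(\<lambda>i. q (f i)) \<longlonglongrightarrow> c * p"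
      unfolding c(1)[OF nf] by (intro tendsto_intros f)
    ultimately show ?thesis by (rule LIMSEQ_unique)
  qed
  thus ?thesis using that c(2) unfolding q_def by blast
qed

text \<open>On the circle \<open>X p\<close> is purely imaginary, and doubling the angles turns the
  quotient into \<open>(- a + \<i> * b) / (a + \<i> * b)\<close> with
  \<open>a = sin (\<alpha> / 2) * cosh v\<close> and \<open>b = cos (\<alpha> / 2) * sinh v\<close>.
  Its real part stays below \<open>cos \<alpha>\<close>.\<close>

lemma extremal_arc:
  obtains c where "norm c = 1"
    "\<And>p. p \<in> \<Omega> \<Longrightarrow> norm p = 1 \<Longrightarrow> Re (c * p) < cos \<alpha>"
    "\<And>p. p \<in> \<Omega> \<Longrightarrow> norm p = 1 \<Longrightarrow> c * p = - 1 \<Longrightarrow> p ^ n \<in> \<real>"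
proof -
  obtain c where c: "norm c = 1" "\<And>p. p \<in> \<Omega> \<Longrightarrow> norm p = 1 \<Longrightarrow> \<phi>_0 p / \<phi>_inf p = c * p"
    using extremal_rotation by blast
  have "Re (c * p) < cos \<alpha> \<and> (c * p = - 1 \<longrightarrow> p ^ n \<in> \<real>)" if p: "p \<in> \<Omega>" "norm p = 1" for p
  proof -
    define v where "v = 2 * Im (X p)"
    define C where "C = (exp v + exp (- v)) / 2"
    define S where "S = (exp v - exp (- v)) / 2"
    define a where "a = sin (\<alpha> / 2) * C"
    define b where "b = cos (\<alpha> / 2) * S"
    have C_pos: "C > 0" by (simp add: C_def add_pos_pos)
    have CS: "C\<^sup>2 = S\<^sup>2 + 1"
      by (simp add: C_def S_def power2_eq_square field_simps exp_minus)
    have sin_pos: "sin (\<alpha> / 2) > 0" and cos_pos: "cos (\<alpha> / 2) > 0"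
      using \<alpha>_pos \<alpha>_lt by (auto intro!: sin_gt_zero cos_gt_zero)
    have a_pos: "a > 0" using C_pos sin_pos by (simp add: a_def)
    have X: "2 * X p = Complex 0 v"
      using Re_slit_potential_circle[OF p(2,1)] by (simp add: complex_eq_iff v_def)
    have sin_minus: "sin (2 * X p - of_real (\<alpha> / 2)) = Complex (- a) b"
      unfolding X by (simp add: complex_eq_iff Re_sin Im_sin a_def b_def C_def S_def)
    have sin_plus: "sin (2 * X p + of_real (\<alpha> / 2)) = Complex a b"
      unfolding X by (simp add: complex_eq_iff Re_sin Im_sin a_def b_def C_def S_def)
    have "\<phi>_0 p / \<phi>_inf p
        = (2 * sin (X p - of_real (\<alpha> / 4)) * cos (X p - of_real (\<alpha> / 4))) /
          (2 * sin (X p + of_real (\<alpha> / 4)) * cos (X p + of_real (\<alpha> / 4)))"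
      by (simp add: \<phi>_0_def \<phi>_inf_def)
    also have "\<dots> = sin (2 * X p - of_real (\<alpha> / 2)) / sin (2 * X p + of_real (\<alpha> / 2))"
      unfolding sin_double[symmetric] by (simp add: algebra_simps)
    finally have cp: "c * p = Complex (- a) b / Complex a b"
      using c(2)[OF p] sin_minus sin_plus by simp
    have ab: "a\<^sup>2 + b\<^sup>2 > 0" using a_pos by (simp add: sum_power2_gt_zero_iff)
    have "Re (c * p) = (b\<^sup>2 - a\<^sup>2) / (a\<^sup>2 + b\<^sup>2)"
      unfolding cp by (simp add: Re_divide power2_eq_square)
    also have "\<dots> < cos \<alpha>"
    proof -
      define s where "s = (sin (\<alpha> / 2))\<^sup>2"
      have s: "s > 0" "s < 1"
        using zero_less_power[OF sin_pos, of 2] zero_less_power[OF cos_pos, of 2]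
          sin_cos_squared_add[of "\<alpha> / 2"] unfolding s_def by linarith+
      have k: "(cos (\<alpha> / 2))\<^sup>2 = 1 - s" by (simp add: s_def cos_squared_eq)
      have cos: "cos \<alpha> = 1 - 2 * s"
        using cos_double_sin[of "\<alpha> / 2"] by (simp add: s_def)
      have a2: "a\<^sup>2 = s * (S\<^sup>2 + 1)" by (simp add: a_def s_def power_mult_distrib CS)
      have b2: "b\<^sup>2 = (1 - s) * S\<^sup>2" by (simp add: b_def power_mult_distrib k)
      \<comment> \<open>The terms in \<open>S\<close> cancel, so the gap in the inequality, cleared
        of denominators, does not depend on \<open>p\<close>.\<close>
      have "cos \<alpha> * (a\<^sup>2 + b\<^sup>2) - (b\<^sup>2 - a\<^sup>2) = 2 * (s * (1 - s))"
        unfolding cos a2 b2 by (simp add: algebra_simps)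
      moreover have "s * (1 - s) > 0" using s by simp
      ultimately show ?thesis using ab by (simp add: divide_simps mult.commute)
    qed
    finally have "Re (c * p) < cos \<alpha>" .
    \<comment> \<open>The value -1 forces \<open>b = 0\<close>, hence \<open>X p = 0\<close>. Then
      \<open>\<phi>_inf p\<close> and \<open>jouk (w p)\<close> are real, and the identity
      \<open>G = 1\<close> makes \<open>p ^ n\<close> real.\<close>
    moreover have "p ^ n \<in> \<real>" if "c * p = - 1"
    proof -
      have "Complex a b \<noteq> 0" using a_pos by (simp add: complex_eq_iff)
      hence "Complex (- a) b = - Complex a b" using that unfolding cp by (simp add: field_simps)
      hence "b = 0" by (simp add: complex_eq_iff)
      hence "S = 0" using cos_pos by (simp add: b_def)
      hence "v = 0" by (simp add: S_def)
      hence "X p = 0" using X by (simp add: complex_eq_iff)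
      hence phi: "\<phi>_inf p \<in> \<real>"
        by (simp add: \<phi>_inf_def flip: sin_of_real cos_of_real)
      have "p \<noteq> 0" using p(2) by auto
      have "off_slit (of_real (Re (w p)))"
        using extremal_off_slit[OF p(1) \<open>p \<noteq> 0\<close>] w_circle_real[OF p(2)] by simp
      hence "\<bar>Re (w p)\<bar> > 1" unfolding off_slit_iff by force
      hence j: "jouk (w p) \<in> \<real>" using jouk_real w_circle_real[OF p(2)] by metis
      have "p ^ n = 1 / (jouk (w p) * \<phi>_inf p ^ (2 * n))"
      proof -
        have "jouk (w p) * \<phi>_inf p ^ (2 * n) * p ^ n = 1"
          using extremal_jouk[OF p(1) \<open>p \<noteq> 0\<close>] by (simp add: mult_ac)
        thus ?thesis by (metis eq_divide_eq mult.commute mult_zero_left zero_neq_one)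
      qed
      thus ?thesis using j phi by (auto intro!: Reals_divide Reals_mult Reals_power)
    qed
    ultimately show ?thesis by blast
  qed
  thus ?thesis using that c(1) by blast
qed

end

section \<open>Periodic sets and trigonometric polynomials\<close>

lemma periodic_set_int:
  assumes "periodic_set Q"
  shows "t + 2 * pi * of_int m \<in> Q \<longleftrightarrow> t \<in> Q"
proof -
  have nat: "t + 2 * pi * real k \<in> Q \<longleftrightarrow> t \<in> Q" for k t
  proof (induction k)
    case (Suc k)
    have "t + 2 * pi * real (Suc k) = (t + 2 * pi * real k) + 2 * pi"
      by (simp add: algebra_simps)
    thus ?case using Suc assms unfolding periodic_set_def by metis
  qed simp
  show ?thesis
  proof (cases "m \<ge> 0")
    case True
    thus ?thesis using nat[of t "nat m"] by simp
  next
    case False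
    thus ?thesis using nat[of "t + 2 * pi * of_int m" "nat (- m)"] by simp
  qed
qed

lemma reduce_2pi:
  obtains m :: int where "c \<le> t - 2 * pi * of_int m" "t - 2 * pi * of_int m < c + 2 * pi"
proof
  let ?x = "(t - c) / (2 * pi)"
  have "of_int \<lfloor>?x\<rfloor> \<le> ?x" "?x < of_int \<lfloor>?x\<rfloor> + 1" by linarith+
  hence "of_int \<lfloor>?x\<rfloor> * (2 * pi) \<le> t - c" "t - c < (of_int \<lfloor>?x\<rfloor> + 1) * (2 * pi)"
    by (simp_all only: pos_le_divide_eq[of "2 * pi"] pos_divide_less_eq[of "2 * pi"] pi_gt_zero
          zero_less_mult_iff zero_less_numeral simp_thms)
  thus "c \<le> t - 2 * pi * of_int \<lfloor>?x\<rfloor>" "t - 2 * pi * of_int \<lfloor>?x\<rfloor> < c + 2 * pi"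
    by (simp_all add: algebra_simps)
qed

lemma cis_add_2pi_int: "cis (t + 2 * pi * of_int m) = cis t"
  by (simp add: cis_mult[symmetric] cis_multiple_2pi)

lemma periodic_cis_iff:
  assumes "periodic_set Q"
  shows "cis t \<in> cis ` (Q \<inter> {0..<2*pi}) \<longleftrightarrow> t \<in> Q"
proof -
  obtain m :: int where m: "0 \<le> t - 2 * pi * of_int m" "t - 2 * pi * of_int m < 0 + 2 * pi"
    by (rule reduce_2pi)
  define s where "s = t - 2 * pi * of_int m"
  have t: "t = s + 2 * pi * of_int m" by (simp add: s_def)
  have s: "s \<in> {0..<2*pi}" using m by (simp add: s_def)
  have "cis t \<in> cis ` (Q \<inter> {0..<2*pi}) \<longleftrightarrow> cis s \<in> cis ` (Q \<inter> {0..<2*pi})"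
    by (simp only: t cis_add_2pi_int)
  also have "\<dots> \<longleftrightarrow> s \<in> Q"
    using s cis_inj_on by (auto simp: inj_on_def)
  also have "\<dots> \<longleftrightarrow> t \<in> Q"
    by (simp only: t periodic_set_int[OF assms])
  finally show ?thesis .
qed

lemma closed_cis_periodic:
  assumes "torus_compact Q"
  shows "closed (cis ` (Q \<inter> {0..<2*pi}))"
proof -
  have Q: "closed Q" "periodic_set Q" using assms by (auto simp: torus_compact_def)
  have "compact (Q \<inter> {0..2*pi})" using Q(1) by (intro closed_Int_compact) auto
  hence "closed (cis ` (Q \<inter> {0..2*pi}))"
    by (intro compact_imp_closed compact_continuous_image continuous_intros)
  \<comment> \<open>Compactness needs the closed interval; the added endpoint contributes no new
    point of the circle.\<close>
  moreover have "cis ` (Q \<inter> {0..2*pi}) = cis ` (Q \<inter> {0..<2*pi})"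
    using periodic_cis_iff[OF Q(2)] by fastforce
  ultimately show ?thesis by simp
qed

lemma measure_periodic_shift:
  assumes "torus_compact Q" "0 \<le> c" "c \<le> 2 * pi"
  shows "torus_mes Q = measure lebesgue (Q \<inter> {c..<c + 2 * pi})"
proof -
  have Q: "closed Q" "periodic_set Q" using assms by (auto simp: torus_compact_def)
  have lm: "Q \<inter> {a..<b} \<in> lmeasurable" for a b
  proof (rule fmeasurableI2[of "{a..b}"])
    show "Q \<inter> {a..<b} \<in> sets lebesgue" using Q(1) by (intro sets.Int) auto
  qed auto
  have split: "measure lebesgue (Q \<inter> {a..<b}) = measure lebesgue (Q \<inter> {a..<m}) + measure lebesgue (Q \<inter> {m..<b})"
    if "a \<le> m" "m \<le> b" for a b m
  proof -
    have "Q \<inter> {a..<b} = (Q \<inter> {a..<m}) \<union> (Q \<inter> {m..<b})" using that by auto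
    moreover have "measure lebesgue ((Q \<inter> {a..<m}) \<union> (Q \<inter> {m..<b}))
        = measure lebesgue (Q \<inter> {a..<m}) + measure lebesgue (Q \<inter> {m..<b})"
      by (intro measure_Un2[THEN trans]) (auto simp: lm intro!: arg_cong[where f = "measure lebesgue"])
    ultimately show ?thesis by simp
  qed
  \<comment> \<open>Moving the window from 0 to \<open>c\<close> drops the part of \<open>Q\<close>
    in \<open>{0..<c}\<close> and gains its translate by \<open>2 * pi\<close>.\<close>
  have "(+) (2 * pi) ` (Q \<inter> {0..<c}) = Q \<inter> {2 * pi..<c + 2 * pi}"
  proof (intro equalityI subsetI)
    fix x assume "x \<in> (+) (2 * pi) ` (Q \<inter> {0..<c})"
    thus "x \<in> Q \<inter> {2 * pi..<c + 2 * pi}"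
      using Q(2) by (auto simp: periodic_set_def add.commute)
  next
    fix x assume x: "x \<in> Q \<inter> {2 * pi..<c + 2 * pi}"
    hence "x - 2 * pi \<in> Q" using Q(2) unfolding periodic_set_def by (metis IntD1 diff_add_cancel)
    thus "x \<in> (+) (2 * pi) ` (Q \<inter> {0..<c})"
      using x by (intro image_eqI[of _ _ "x - 2 * pi"]) auto
  qed
  hence "measure lebesgue (Q \<inter> {2 * pi..<c + 2 * pi}) = measure lebesgue (Q \<inter> {0..<c})"
    using measure_translation[of "2 * pi" "Q \<inter> {0..<c}"] by simp
  thus ?thesis
    using split[of 0 c "2 * pi"] split[of c "2 * pi" "c + 2 * pi"] assms(2,3)
    by (simp add: torus_mes_def)
qed

lemma cos_ge_iff:
  assumes "0 < \<alpha>" "\<alpha> < pi"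
  shows "cos x \<ge> cos \<alpha> \<longleftrightarrow> (\<exists>m::int. \<bar>x - 2 * pi * of_int m\<bar> \<le> \<alpha>)"
proof -
  have core: "cos y \<ge> cos \<alpha> \<longleftrightarrow> \<bar>y\<bar> \<le> \<alpha>" if "\<bar>y\<bar> \<le> pi" for y
    using cos_mono_le_eq[of \<alpha> "\<bar>y\<bar>"] that assms by simp
  have per: "cos (x - 2 * pi * of_int m) = cos x" for m :: int
    using cos_int_2pin[of m] sin_int_2pin[of m] by (simp add: cos_diff mult_ac)
  show ?thesis
  proof
    assume "cos x \<ge> cos \<alpha>"
    obtain m :: int where "- pi \<le> x - 2 * pi * of_int m" "x - 2 * pi * of_int m < - pi + 2 * pi"
      by (rule reduce_2pi)
    thus "\<exists>m::int. \<bar>x - 2 * pi * of_int m\<bar> \<le> \<alpha>"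
      using core[of "x - 2 * pi * of_int m"] per[of m] \<open>cos x \<ge> cos \<alpha>\<close>
      by (intro exI[of _ m]) (auto simp: abs_le_iff)
  next
    assume "\<exists>m::int. \<bar>x - 2 * pi * of_int m\<bar> \<le> \<alpha>"
    then obtain m :: int where "\<bar>x - 2 * pi * of_int m\<bar> \<le> \<alpha>" by blast
    thus "cos x \<ge> cos \<alpha>"
      using core[of "x - 2 * pi * of_int m"] per[of m] assms by auto
  qed
qed

section \<open>Closed arcs\<close>

text \<open>The cosine form makes closedness and periodicity immediate and allows an arbitrary
  centre.\<close>

definition arc :: "real \<Rightarrow> real \<Rightarrow> real set" where
  "arc \<alpha> \<xi> = {t. cos (t - \<xi>) \<ge> cos \<alpha>}"

lemma seg_eq_arc:
  assumes "0 < \<alpha>" "\<alpha> < pi"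
  shows "seg n \<alpha> k = arc \<alpha> (of_int k * pi / real n)"
  unfolding seg_def arc_def cos_ge_iff[OF assms] by simp

lemma torus_compact_arc: "torus_compact (arc \<alpha> \<xi>)"
proof -
  have "closed (arc \<alpha> \<xi>)"
    unfolding arc_def by (intro closed_Collect_le continuous_intros)
  moreover have "cos (t + 2 * pi - \<xi>) = cos (t - \<xi>)" for t
    using cos_periodic[of "t - \<xi>"] by (simp add: algebra_simps)
  ultimately show ?thesis
    by (simp add: torus_compact_def periodic_set_def arc_def)
qed

text \<open>The range of \<open>\<xi>\<close> puts the left end \<open>\<xi> - pi\<close> of the
  window centred at \<open>\<xi>\<close> into \<open>[0, 2 * pi]\<close>, as
  \<open>measure_periodic_shift\<close> requires.\<close>

lemma torus_mes_arc:
  assumes "0 < \<alpha>" "\<alpha> < pi" "pi \<le> \<xi>" "\<xi> \<le> 3 * pi"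
  shows "torus_mes (arc \<alpha> \<xi>) = 2 * \<alpha>"
proof -
  have "torus_mes (arc \<alpha> \<xi>) = measure lebesgue (arc \<alpha> \<xi> \<inter> {\<xi> - pi..<\<xi> - pi + 2 * pi})"
    using assms by (intro measure_periodic_shift torus_compact_arc) auto
  also have "arc \<alpha> \<xi> \<inter> {\<xi> - pi..<\<xi> - pi + 2 * pi} = {\<xi> - \<alpha>..\<xi> + \<alpha>}"
  proof -
    have "cos (t - \<xi>) \<ge> cos \<alpha> \<longleftrightarrow> \<bar>t - \<xi>\<bar> \<le> \<alpha>" if "t \<in> {\<xi> - pi..<\<xi> - pi + 2 * pi}" for t
      using cos_mono_le_eq[of \<alpha> "\<bar>t - \<xi>\<bar>"] that assms by (simp add: abs_le_iff)
    thus ?thesis using assms by (auto simp: arc_def abs_le_iff)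
  qed
  also have "measure lebesgue {\<xi> - \<alpha>..\<xi> + \<alpha>} = 2 * \<alpha>" using assms by simp
  finally show ?thesis .
qed

text \<open>The polynomials \<open>2 z\<^sup>n (cos nt - f(t))\<close>, \<open>z = e\<^sup>i\<^sup>t\<close>, with \<open>f\<close> of order below \<open>n\<close>.\<close>

definition self_reciprocal :: "nat \<Rightarrow> complex poly \<Rightarrow> bool" where
  "self_reciprocal n P \<longleftrightarrow> degree P \<le> 2 * n \<and> poly P 0 = 1 \<and>
     (\<forall>z. z \<noteq> 0 \<longrightarrow> poly P (1 / cnj z) = cnj (poly P z) / cnj z ^ (2 * n))"

lemma trig_poly_self_reciprocal:
  assumes "n \<ge> 1" "trig_poly (n - 1) f"
  obtains P where "self_reciprocal n P"
    "\<And>t. poly P (cis t) = 2 * cis (real n * t) * of_real (cos (real n * t) - f t)"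
proof -
  obtain a b :: "nat \<Rightarrow> real" where
    f: "f = (\<lambda>t. \<Sum>k\<le>n-1. a k * cos (real k * t) + b k * sin (real k * t))"
    using assms(2) by (auto simp: trig_poly_def)
  \<comment> \<open>With this choice \<open>a k * cos (k * t) + b k * sin (k * t)\<close> is the
    real part of \<open>c k * cis (k * t)\<close>. The exponents \<open>n + k\<close> and
    \<open>n - k\<close> stay strictly between 0 and \<open>2 * n\<close>, so the constant term of
    \<open>P\<close> is 1.\<close>
  define c where "c k = Complex (a k) (- b k)" for k
  define P where "P = monom 1 (2 * n) + 1 - (\<Sum>k\<le>n-1. monom (c k) (n + k) + monom (cnj (c k)) (n - k))"
  have poly_P: "poly P z = z ^ (2 * n) + 1 - (\<Sum>k\<le>n-1. c k * z ^ (n + k) + cnj (c k) * z ^ (n - k))" for z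
    by (simp add: P_def poly_sum poly_monom)
  have "degree P \<le> 2 * n"
    unfolding P_def
    by (intro degree_diff_le degree_add_le degree_sum_le order_trans[OF degree_monom_le]) (use assms in auto)
  moreover have "poly P 0 = 1"
    using assms(1) by (auto simp: poly_P zero_power intro!: sum.neutral)
  moreover have "poly P (1 / cnj z) = cnj (poly P z) / cnj z ^ (2 * n)" if "z \<noteq> 0" for z
  proof -
    define y where "y = cnj z"
    have y: "y \<noteq> 0" using that by (simp add: y_def)
    have e: "(1 / y) ^ (n + k) * y ^ (2 * n) = y ^ (n - k)" "(1 / y) ^ (n - k) * y ^ (2 * n) = y ^ (n + k)"
      if "k \<le> n - 1" for k
    proof -
      have "2 * n = (n + k) + (n - k)" using that assms(1) by simp
      hence "y ^ (2 * n) = y ^ (n + k) * y ^ (n - k)" by (metis power_add)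
      thus "(1 / y) ^ (n + k) * y ^ (2 * n) = y ^ (n - k)" "(1 / y) ^ (n - k) * y ^ (2 * n) = y ^ (n + k)"
        using y by (simp_all add: power_divide)
    qed
    have "poly P (1 / y) * y ^ (2 * n) = (1 / y) ^ (2 * n) * y ^ (2 * n) + y ^ (2 * n)
        - (\<Sum>k\<le>n-1. c k * ((1 / y) ^ (n + k) * y ^ (2 * n)) + cnj (c k) * ((1 / y) ^ (n - k) * y ^ (2 * n)))"
      by (simp add: poly_P algebra_simps sum_distrib_left sum_distrib_right sum.distrib)
    also have "\<dots> = 1 + y ^ (2 * n) - (\<Sum>k\<le>n-1. c k * y ^ (n - k) + cnj (c k) * y ^ (n + k))"
    proof -
      have "(1 / y) ^ (2 * n) * y ^ (2 * n) = 1" using y by (simp add: power_divide)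
      thus ?thesis using e by (intro arg_cong2[where f = "(-)"] arg_cong2[where f = "(+)"] sum.cong) auto
    qed
    also have "\<dots> = cnj (poly P z)"
      by (simp add: poly_P y_def algebra_simps)
    finally show ?thesis using y unfolding y_def[symmetric] by (simp add: field_simps)
  qed
  moreover have "poly P (cis t) = 2 * cis (real n * t) * of_real (cos (real n * t) - f t)" for t
  proof -
    have cp: "cis t ^ m = cis (real m * t)" for m by (simp add: Complex.DeMoivre)
    have k: "c k * cis t ^ (n + k) + cnj (c k) * cis t ^ (n - k)
        = 2 * cis (real n * t) * of_real (a k * cos (real k * t) + b k * sin (real k * t))"
      if "k \<le> n - 1" for k
    proof -
      have e1: "cis t ^ (n + k) = cis (real n * t) * cis (real k * t)"
        by (simp add: cp power_add)
      have e2: "cis t ^ (n - k) = cis (real n * t) * cis (- (real k * t))"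
      proof -
        have "real (n - k) * t = real n * t + - (real k * t)"
          using that assms(1) by (simp add: of_nat_diff algebra_simps)
        thus ?thesis by (simp only: cp cis_mult)
      qed
      have e3: "c k * cis (real k * t) + cnj (c k) * cis (- (real k * t))
          = 2 * of_real (a k * cos (real k * t) + b k * sin (real k * t))"
        by (simp add: c_def complex_eq_iff)
      have "c k * cis t ^ (n + k) + cnj (c k) * cis t ^ (n - k)
          = cis (real n * t) * (c k * cis (real k * t) + cnj (c k) * cis (- (real k * t)))"
        unfolding e1 e2 by (simp only: distrib_left mult_ac)
      thus ?thesis unfolding e3 by (simp only: mult_ac)
    qed
    have "cis t ^ (2 * n) + 1 = 2 * cis (real n * t) * of_real (cos (real n * t))"
    proof -
      have "cis t ^ (2 * n) = cis (real n * t) * cis (real n * t)"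
        by (simp add: mult_2 power_add cp)
      moreover have "1 = cis (real n * t) * cis (- (real n * t))" by (simp add: cis_mult)
      moreover have "cis (real n * t) + cis (- (real n * t)) = 2 * of_real (cos (real n * t))"
        by (simp add: complex_eq_iff)
      ultimately show ?thesis by (metis distrib_left mult.assoc mult.commute)
    qed
    thus ?thesis
      unfolding poly_P f of_real_diff right_diff_distrib of_real_sum sum_distrib_left
      using k by (intro arg_cong2[where f = "(-)"] sum.cong) auto
  qed
  ultimately show ?thesis using that unfolding self_reciprocal_def by blast
qed

section \<open>Compactness of bounded families of polynomials\<close>

lemma common_convergent_subsequence:
  fixes x :: "nat \<Rightarrow> 'b \<Rightarrow> complex"
  assumes "finite A" "\<And>a. a \<in> A \<Longrightarrow> bounded (range (\<lambda>k. x k a))"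
  shows "\<exists>r v. strict_mono (r :: nat \<Rightarrow> nat) \<and> (\<forall>a\<in>A. (\<lambda>k. x (r k) a) \<longlonglongrightarrow> v a)"
  using assms
proof (induction A rule: finite_induct)
  case empty
  show ?case using strict_mono_id by auto
next
  case (insert b A)
  then obtain r v where r: "strict_mono (r :: nat \<Rightarrow> nat)" "\<forall>a\<in>A. (\<lambda>k. x (r k) a) \<longlonglongrightarrow> v a"
    by auto
  have "bounded (range (\<lambda>k. x (r k) b))"
    by (rule bounded_subset[OF insert.prems[of b]]) auto
  then obtain l s where s: "strict_mono (s :: nat \<Rightarrow> nat)" "((\<lambda>k. x (r k) b) \<circ> s) \<longlonglongrightarrow> l"
    using bounded_imp_convergent_subsequence by blast
  have "(\<lambda>k. x ((r \<circ> s) k) a) \<longlonglongrightarrow> (v(b := l)) a" if "a \<in> insert b A" for a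
  proof (cases "a = b")
    case True
    thus ?thesis using s(2) by (simp add: o_def)
  next
    case False
    hence "(\<lambda>k. x (r k) a) \<longlonglongrightarrow> v a" using r(2) that by auto
    from LIMSEQ_subseq_LIMSEQ[OF this s(1)] False show ?thesis by (simp add: o_def)
  qed
  thus ?case using strict_mono_o[OF r(1) s(1)] by blast
qed

definition lagrange_basis :: "complex set \<Rightarrow> complex \<Rightarrow> complex poly" where
  "lagrange_basis A a = (\<Prod>b\<in>A - {a}. smult (1 / (a - b)) [:- b, 1:])"

lemma poly_lagrange_basis:
  assumes "finite A" "a \<in> A" "c \<in> A"
  shows "poly (lagrange_basis A a) c = (if c = a then 1 else 0)"
proof (cases "c = a")
  case True
  thus ?thesis
    by (auto simp: lagrange_basis_def poly_prod simp flip: diff_divide_distrib intro!: prod.neutral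
          split: if_splits)
next
  case False
  thus ?thesis using assms by (auto simp: lagrange_basis_def poly_prod intro!: bexI[of _ c])
qed

lemma degree_lagrange_basis:
  assumes "finite A" "a \<in> A"
  shows "degree (lagrange_basis A a) < card A"
proof -
  have "degree (lagrange_basis A a) \<le> (\<Sum>b\<in>A - {a}. degree (smult (1 / (a - b)) [:- b, 1:]))"
    unfolding lagrange_basis_def
    by (rule order_trans[OF degree_prod_sum_le]) (use assms(1) in \<open>auto simp only: o_def finite_Diff order_refl\<close>)
  also have "\<dots> \<le> (\<Sum>b\<in>A - {a}. 1)"
    by (intro sum_mono order_trans[OF degree_smult_le]) simp
  also have "\<dots> < card A" using assms card_gt_0_iff[of A] by auto
  finally show ?thesis .
qed

lemma lagrange_interpolation:
  assumes "finite A" "degree p < card A"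
  shows "p = (\<Sum>a\<in>A. smult (poly p a) (lagrange_basis A a))"
proof (rule poly_eqI_degree[of A])
  fix c assume "c \<in> A"
  thus "poly p c = poly (\<Sum>a\<in>A. smult (poly p a) (lagrange_basis A a)) c"
    using assms(1) by (simp add: poly_sum poly_lagrange_basis if_distrib[of "\<lambda>x. _ * x"] cong: if_cong)
next
  show "degree (\<Sum>a\<in>A. smult (poly p a) (lagrange_basis A a)) < card A"
    using assms degree_lagrange_basis
    by (intro degree_sum_less) (auto intro: le_less_trans[OF degree_smult_le])
qed (use assms in auto)

text \<open>Polynomials of degree at most \<open>2 * n\<close> are determined by their values at
  \<open>2 * n + 1\<close> points. Bounded values there have a convergent subsequence, interpolation
  extends the convergence to the plane, and all conditions pass to the limit.\<close>

lemma self_reciprocal_compactness: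
  assumes inf: "infinite (cis ` Q)"
    and P: "\<And>k. self_reciprocal n (P k)"
    and bound: "\<And>k t. t \<in> Q \<Longrightarrow> norm (poly (P k) (cis t)) \<le> 2 * (M + 1 / real (Suc k))"
  obtains R where "self_reciprocal n R" "\<And>t. t \<in> Q \<Longrightarrow> norm (poly R (cis t)) \<le> 2 * M"
proof -
  obtain A where A: "A \<subseteq> cis ` Q" "finite A" "card A = Suc (2 * n)"
    using infinite_arbitrarily_large[OF inf] by blast
  have "bounded (range (\<lambda>k. poly (P k) a))" if "a \<in> A" for a
  proof -
    obtain t where t: "t \<in> Q" "a = cis t" using A(1) \<open>a \<in> A\<close> by blast
    have "norm (poly (P k) a) \<le> 2 * (M + 1)" for k
    proof -
      have "norm (poly (P k) a) \<le> 2 * (M + 1 / real (Suc k))" using bound t by simp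
      also have "\<dots> \<le> 2 * (M + 1)" by (intro mult_left_mono add_left_mono) auto
      finally show ?thesis .
    qed
    thus ?thesis by (auto simp: bounded_iff)
  qed
  from common_convergent_subsequence[of A "\<lambda>k a. poly (P k) a", OF A(2) this]
  obtain r v where r: "strict_mono (r :: nat \<Rightarrow> nat)" "\<And>a. a \<in> A \<Longrightarrow> (\<lambda>k. poly (P (r k)) a) \<longlonglongrightarrow> v a"
    by blast
  define R where "R = (\<Sum>a\<in>A. smult (v a) (lagrange_basis A a))"
  have deg: "degree (P k) < card A" for k
    using P[of k] A(3) by (simp add: self_reciprocal_def)
  have lim: "(\<lambda>k. poly (P (r k)) z) \<longlonglongrightarrow> poly R z" for z
  proof -
    have "(\<lambda>k. \<Sum>a\<in>A. poly (P (r k)) a * poly (lagrange_basis A a) z) \<longlonglongrightarrow>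
        (\<Sum>a\<in>A. v a * poly (lagrange_basis A a) z)"
      by (intro tendsto_intros r(2))
    moreover have "poly (P k) z = (\<Sum>a\<in>A. poly (P k) a * poly (lagrange_basis A a) z)" for k
      by (subst lagrange_interpolation[OF A(2) deg[of k]]) (simp add: poly_sum)
    ultimately show ?thesis by (simp add: R_def poly_sum)
  qed
  have "degree R < card A"
    unfolding R_def using A(2,3) degree_lagrange_basis[OF A(2)]
    by (intro degree_sum_less) (auto intro: le_less_trans[OF degree_smult_le])
  hence "degree R \<le> 2 * n" using A(3) by simp
  moreover have "poly R 0 = 1"
    using lim[of 0] P by (simp add: self_reciprocal_def LIMSEQ_const_iff)
  moreover have "poly R (1 / cnj z) = cnj (poly R z) / cnj z ^ (2 * n)" if "z \<noteq> 0" for z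
  proof (rule LIMSEQ_unique[OF lim])
    have "(\<lambda>k. cnj (poly (P (r k)) z) / cnj z ^ (2 * n)) \<longlonglongrightarrow> cnj (poly R z) / cnj z ^ (2 * n)"
      using that by (intro tendsto_intros lim) auto
    thus "(\<lambda>k. poly (P (r k)) (1 / cnj z)) \<longlonglongrightarrow> cnj (poly R z) / cnj z ^ (2 * n)"
      using P that by (simp add: self_reciprocal_def)
  qed
  moreover have "norm (poly R (cis t)) \<le> 2 * M" if "t \<in> Q" for t
  proof (rule LIMSEQ_le)
    show "(\<lambda>k. norm (poly (P (r k)) (cis t))) \<longlonglongrightarrow> norm (poly R (cis t))"
      by (intro tendsto_intros lim)
    have "(\<lambda>k. 2 * (M + inverse (real (Suc (r k))))) \<longlonglongrightarrow> 2 * (M + 0)"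
      using LIMSEQ_subseq_LIMSEQ[OF LIMSEQ_inverse_real_of_nat r(1)]
      by (intro tendsto_intros) (simp add: o_def)
    thus "(\<lambda>k. 2 * (M + 1 / real (Suc (r k)))) \<longlonglongrightarrow> 2 * M" by (simp add: inverse_eq_divide)
    show "\<exists>N. \<forall>k\<ge>N. norm (poly (P (r k)) (cis t)) \<le> 2 * (M + 1 / real (Suc (r k)))"
      using bound[OF that] by blast
  qed
  ultimately show ?thesis using that unfolding self_reciprocal_def by blast
qed

section \<open>Closure properties of trigonometric polynomials\<close>

lemma trig_poly_cos: "k \<le> m \<Longrightarrow> trig_poly m (\<lambda>t. c * cos (real k * t))"
  unfolding trig_poly_def
  by (intro exI[of _ "\<lambda>j. if j = k then c else 0"] exI[of _ "\<lambda>_. 0"])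
     (auto simp: if_distrib[of "\<lambda>x. x * _"] cong: if_cong)

lemma trig_poly_sin: "k \<le> m \<Longrightarrow> trig_poly m (\<lambda>t. c * sin (real k * t))"
  unfolding trig_poly_def
  by (intro exI[of _ "\<lambda>_. 0"] exI[of _ "\<lambda>j. if j = k then c else 0"])
     (auto simp: if_distrib[of "\<lambda>x. x * _"] cong: if_cong)

lemma trig_poly_const: "trig_poly m (\<lambda>_. c)"
  using trig_poly_cos[of 0 m c] by simp

lemma trig_poly_add:
  assumes "trig_poly m f" "trig_poly m g"
  shows "trig_poly m (\<lambda>t. f t + g t)"
proof -
  obtain a b a' b' where
    "f = (\<lambda>t. \<Sum>k\<le>m. a k * cos (real k * t) + b k * sin (real k * t))"
    "g = (\<lambda>t. \<Sum>k\<le>m. a' k * cos (real k * t) + b' k * sin (real k * t))"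
    using assms unfolding trig_poly_def by blast
  thus ?thesis unfolding trig_poly_def
    by (intro exI[of _ "\<lambda>k. a k + a' k"] exI[of _ "\<lambda>k. b k + b' k"])
       (simp add: algebra_simps sum.distrib)
qed

lemma trig_poly_cmult:
  assumes "trig_poly m f"
  shows "trig_poly m (\<lambda>t. c * f t)"
proof -
  obtain a b where "f = (\<lambda>t. \<Sum>k\<le>m. a k * cos (real k * t) + b k * sin (real k * t))"
    using assms unfolding trig_poly_def by blast
  thus ?thesis unfolding trig_poly_def
    by (intro exI[of _ "\<lambda>k. c * a k"] exI[of _ "\<lambda>k. c * b k"])
       (simp add: algebra_simps sum_distrib_left)
qed

lemma trig_poly_sum:
  assumes "finite S" "\<And>k. k \<in> S \<Longrightarrow> trig_poly m (f k)"
  shows "trig_poly m (\<lambda>t. \<Sum>k\<in>S. f k t)"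
  using assms by (induction S rule: finite_induct) (auto intro: trig_poly_const trig_poly_add)

lemma trig_poly_mono:
  assumes "trig_poly m f" "m \<le> m'"
  shows "trig_poly m' f"
proof -
  obtain a b where f: "f = (\<lambda>t. \<Sum>k\<le>m. a k * cos (real k * t) + b k * sin (real k * t))"
    using assms unfolding trig_poly_def by blast
  show ?thesis unfolding f
    by (intro trig_poly_sum trig_poly_add trig_poly_cos trig_poly_sin) (use assms(2) in auto)
qed

lemma trig_poly_shift:
  assumes "trig_poly m f"
  shows "trig_poly m (\<lambda>t. f (t - \<xi>))"
proof -
  obtain a b where f: "f = (\<lambda>t. \<Sum>k\<le>m. a k * cos (real k * t) + b k * sin (real k * t))"
    using assms unfolding trig_poly_def by blast
  have "(\<lambda>t. f (t - \<xi>)) = (\<lambda>t. \<Sum>k\<le>m.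
      (a k * cos (real k * \<xi>) - b k * sin (real k * \<xi>)) * cos (real k * t) +
      (a k * sin (real k * \<xi>) + b k * cos (real k * \<xi>)) * sin (real k * t))"
    unfolding f by (intro ext sum.cong) (auto simp: algebra_simps cos_diff sin_diff)
  thus ?thesis unfolding trig_poly_def
    by (intro exI[of _ "\<lambda>k. a k * cos (real k * \<xi>) - b k * sin (real k * \<xi>)"]
          exI[of _ "\<lambda>k. a k * sin (real k * \<xi>) + b k * cos (real k * \<xi>)"])
qed

lemma trig_poly_times_cos:
  assumes "trig_poly m f"
  shows "trig_poly (Suc m) (\<lambda>t. cos t * f t)"
proof -
  obtain a b where f: "f = (\<lambda>t. \<Sum>k\<le>m. a k * cos (real k * t) + b k * sin (real k * t))"
    using assms unfolding trig_poly_def by blast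
  have "trig_poly (Suc m) (\<lambda>t. cos t * (a k * cos (real k * t) + b k * sin (real k * t)))" if "k \<le> m" for k
  proof (cases k)
    case 0
    thus ?thesis using trig_poly_cos[of 1 "Suc m" "a 0"] by (simp add: mult.commute)
  next
    case (Suc j)
    have eq: "(\<lambda>t. cos t * (a k * cos (real k * t) + b k * sin (real k * t))) =
       (\<lambda>t. (a k / 2 * cos (real (Suc k) * t) + a k / 2 * cos (real j * t)) +
       (b k / 2 * sin (real (Suc k) * t) + b k / 2 * sin (real j * t)))"
    proof
      fix t
      have 1: "real (Suc k) * t = real k * t + t" "real j * t = real k * t - t"
        by (simp_all add: Suc algebra_simps)
      show "cos t * (a k * cos (real k * t) + b k * sin (real k * t)) =
       (a k / 2 * cos (real (Suc k) * t) + a k / 2 * cos (real j * t)) +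
       (b k / 2 * sin (real (Suc k) * t) + b k / 2 * sin (real j * t))"
        unfolding 1 cos_add cos_diff sin_add sin_diff by (simp add: field_simps)
    qed
    show ?thesis
      unfolding eq by (intro trig_poly_add trig_poly_cos trig_poly_sin) (use Suc that in auto)
  qed
  thus ?thesis unfolding f sum_distrib_left by (intro trig_poly_sum) auto
qed

lemma trig_poly_bounded:
  assumes "trig_poly m f"
  obtains B where "\<And>t. \<bar>f t\<bar> \<le> B"
proof -
  obtain a b where f: "f = (\<lambda>t. \<Sum>k\<le>m. a k * cos (real k * t) + b k * sin (real k * t))"
    using assms unfolding trig_poly_def by blast
  have "\<bar>f t\<bar> \<le> (\<Sum>k\<le>m. \<bar>a k\<bar> + \<bar>b k\<bar>)" for t
    unfolding f
  proof (rule order_trans[OF sum_abs], rule sum_mono)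
    fix k
    have "\<bar>a k * cos (real k * t)\<bar> \<le> \<bar>a k\<bar>" "\<bar>b k * sin (real k * t)\<bar> \<le> \<bar>b k\<bar>"
      by (simp_all add: abs_mult mult_left_le)
    thus "\<bar>a k * cos (real k * t) + b k * sin (real k * t)\<bar> \<le> \<bar>a k\<bar> + \<bar>b k\<bar>" by linarith
  qed
  thus ?thesis using that by blast
qed

section \<open>Chebyshev polynomials and the upper bound on segments\<close>

fun cheb :: "nat \<Rightarrow> real \<Rightarrow> real" where
  "cheb 0 x = 1"
| "cheb (Suc 0) x = x"
| "cheb (Suc (Suc n)) x = 2 * x * cheb (Suc n) x - cheb n x"

lemma cheb_cos: "cheb n (cos \<theta>) = cos (real n * \<theta>)"
proof (induction n "cos \<theta>" rule: cheb.induct)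
  case (3 n)
  have 1: "real (Suc (Suc n)) * \<theta> = real (Suc n) * \<theta> + \<theta>" "real n * \<theta> = real (Suc n) * \<theta> - \<theta>"
    by (simp_all add: algebra_simps)
  show ?case
    unfolding cheb.simps 3 1 cos_add cos_diff by simp
qed auto

lemma abs_cheb_le_1:
  assumes "\<bar>x\<bar> \<le> 1"
  shows "\<bar>cheb n x\<bar> \<le> 1"
  using cheb_cos[of n "arccos x"] assms by (simp add: cos_arccos_abs)

text \<open>For \<open>N = Suc n\<close>, the leading coefficient \<open>2 ^ (N - 1)\<close> of the
  Chebyshev polynomial cancels the factor with which \<open>cos (N * t)\<close> occurs in
  \<open>cos t ^ N\<close>, leaving exactly \<open>A ^ N\<close>.\<close>

lemma cheb_trig_poly:
  "\<exists>g. trig_poly n g \<and> (\<forall>t. cheb (Suc n) (A * cos t + B) = A ^ Suc n * cos (real (Suc n) * t) + g t)"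
proof (induction n rule: less_induct)
  case (less n)
  \<comment> \<open>\<open>cheb 2\<close> refers back to \<open>cheb 0\<close>, which is not of the
    form \<open>cheb (Suc m)\<close>, so \<open>n = 1\<close> is computed separately.\<close>
  consider "n = 0" | "n = 1" | m where "n = Suc (Suc m)" by (metis One_nat_def old.nat.exhaust)
  thus ?case
  proof cases
    case 1
    thus ?thesis by (intro exI[of _ "\<lambda>_. B"]) (auto intro: trig_poly_const)
  next
    case 2
    have "cheb (Suc n) (A * cos t + B) = A ^ Suc n * cos (real (Suc n) * t)
        + (4 * A * B * cos (real 1 * t) + (A\<^sup>2 + 2 * B\<^sup>2 - 1))" for t
    proof -
      have c2: "cos (real (Suc 1) * t) = 2 * (cos t)\<^sup>2 - 1" by (simp add: cos_double_cos)
      show ?thesis unfolding 2 c2 by (simp add: power2_eq_square algebra_simps)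
    qed
    moreover have "trig_poly n (\<lambda>t. 4 * A * B * cos (real 1 * t) + (A\<^sup>2 + 2 * B\<^sup>2 - 1))"
      using 2 by (intro trig_poly_add trig_poly_cos trig_poly_const) auto
    ultimately show ?thesis by blast
  next
    case (3 m)
    obtain g where g: "trig_poly m g"
      "\<And>t. cheb (Suc m) (A * cos t + B) = A ^ Suc m * cos (real (Suc m) * t) + g t"
      using less.IH[of m] 3 by auto
    obtain h where h: "trig_poly (Suc m) h"
      "\<And>t. cheb (Suc (Suc m)) (A * cos t + B) = A ^ Suc (Suc m) * cos (real (Suc (Suc m)) * t) + h t"
      using less.IH[of "Suc m"] 3 by auto
    \<comment> \<open>The product \<open>2 * A * cos t * A ^ n * cos (n * t)\<close> splits into the
      wanted top term and the term of order \<open>n - 1 = Suc m\<close>, which goes into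
      \<open>q\<close>.\<close>
    define q where "q = (\<lambda>t. A ^ n * A * cos (real (Suc m) * t) + 2 * A * (cos t * h t)
      + (2 * B * (A ^ n * cos (real n * t)) + 2 * B * h t)
      + ((- (A ^ Suc m)) * cos (real (Suc m) * t) + (- 1) * g t))"
    have "cheb (Suc n) (A * cos t + B) = A ^ Suc n * cos (real (Suc n) * t) + q t" for t
    proof -
      have e: "real (Suc n) * t = real n * t + t" "real (Suc m) * t = real n * t - t"
        by (simp_all add: 3 algebra_simps)
      have "cheb (Suc n) (A * cos t + B) = 2 * (A * cos t + B) * (A ^ n * cos (real n * t) + h t)
          - (A ^ Suc m * cos (real (Suc m) * t) + g t)"
        using g(2)[of t] h(2)[of t] 3 by simp
      also have "\<dots> = A ^ Suc n * cos (real (Suc n) * t) + q t"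
        unfolding q_def e cos_add cos_diff by (simp add: algebra_simps)
      finally show ?thesis .
    qed
    moreover have "trig_poly n q"
    proof -
      have "trig_poly n (\<lambda>t. cos t * h t)" using trig_poly_times_cos[OF h(1)] 3 by simp
      moreover have "trig_poly n h" "trig_poly n g"
        using trig_poly_mono[OF h(1)] trig_poly_mono[OF g(1)] 3 by auto
      moreover have "trig_poly n (\<lambda>t. 2 * B * (A ^ n * cos (real n * t)))"
        by (intro trig_poly_cmult trig_poly_cos) auto
      ultimately show ?thesis
        unfolding q_def using 3 by (intro trig_poly_add trig_poly_cos trig_poly_cmult[where f = "\<lambda>t. cos t * h t"]
            trig_poly_cmult[where f = h] trig_poly_cmult[where f = g]) auto
    qed
    ultimately show ?thesis by blast
  qed
qed

text \<open>The argument of \<open>cheb n\<close> is \<open>(1 - cos (t - \<xi>)) / s - 1\<close>,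
  which runs from -1 at the centre of the segment to 1 at its ends. Scaling by \<open>s ^ n\<close>
  and a sign makes the coefficient of \<open>cos (n * t)\<close> equal to 1.\<close>

lemma seg_upper_bound:
  assumes "n \<ge> 1" "0 < \<alpha>" "\<alpha> < pi"
  obtains f where "trig_poly (n - 1) f"
    "\<And>t. t \<in> seg n \<alpha> k \<Longrightarrow> \<bar>cos (real n * t) - f t\<bar> \<le> sin (\<alpha> / 2) ^ (2 * n)"
proof -
  define s where "s = (sin (\<alpha> / 2))\<^sup>2"
  have s: "s > 0" using sin_gt_zero[of "\<alpha> / 2"] assms by (simp add: s_def)
  have cos: "cos \<alpha> = 1 - 2 * s" using cos_double_sin[of "\<alpha> / 2"] by (simp add: s_def)
  define \<xi> where "\<xi> = of_int k * pi / real n"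
  obtain g where g: "trig_poly (n - 1) g"
    "\<And>t. cheb n ((- 1 / s) * cos t + (1 / s - 1)) = (- 1 / s) ^ n * cos (real n * t) + g t"
    using cheb_trig_poly[of "n - 1" "- 1 / s" "1 / s - 1"] assms(1) by auto
  define \<kappa> where "\<kappa> = cos (of_int k * pi)"
  have sin_k: "sin (of_int k * pi) = 0" by (auto simp: sin_zero_iff_int2)
  hence \<kappa>: "\<kappa>\<^sup>2 = 1"
    using sin_cos_squared_add[of "of_int k * pi"] by (simp add: \<kappa>_def)
  \<comment> \<open>This sign undoes both the \<open>(- 1) ^ n\<close> of the leading coefficient
    and the \<open>\<kappa>\<close> from shifting \<open>cos (n * t)\<close> by
    \<open>\<xi>\<close>.\<close>
  define \<epsilon> where "\<epsilon> = (- 1) ^ n * \<kappa>"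
  have e2: "\<epsilon> * ((- 1) ^ n * \<kappa>) = 1"
  proof -
    have "\<epsilon> * ((- 1) ^ n * \<kappa>) = ((- 1) ^ n * (- 1) ^ n) * \<kappa>\<^sup>2"
      by (simp only: \<epsilon>_def power2_eq_square mult_ac)
    thus ?thesis using \<kappa> by simp
  qed
  have eabs: "\<bar>\<epsilon>\<bar> = 1"
    using \<kappa> by (simp add: \<epsilon>_def abs_mult power2_eq_1_iff) auto
  define f where "f = (\<lambda>t. (- \<epsilon> * s ^ n) * g (t - \<xi>))"
  have eq: "cos (real n * t) - f t = \<epsilon> * s ^ n * cheb n ((- 1 / s) * cos (t - \<xi>) + (1 / s - 1))" for t
  proof -
    have "real n * (t - \<xi>) = real n * t - of_int k * pi"
      using assms(1) by (simp add: \<xi>_def field_simps)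
    hence "cos (real n * (t - \<xi>)) = \<kappa> * cos (real n * t)"
      using sin_k by (simp add: cos_diff \<kappa>_def)
    moreover have "s ^ n * (- 1 / s) ^ n = (- 1) ^ n"
      using s by (simp flip: power_mult_distrib)
    ultimately have "\<epsilon> * s ^ n * ((- 1 / s) ^ n * cos (real n * (t - \<xi>))) = \<epsilon> * ((- 1) ^ n * \<kappa>) * cos (real n * t)"
      by (simp only: mult.assoc) (metis mult.assoc)
    thus ?thesis unfolding g(2) f_def e2 by (simp add: distrib_left)
  qed
  show ?thesis
  proof
    show "trig_poly (n - 1) f"
      unfolding f_def by (intro trig_poly_cmult trig_poly_shift g)
    fix t assume "t \<in> seg n \<alpha> k"
    hence c: "cos (t - \<xi>) \<ge> 1 - 2 * s" by (simp add: seg_eq_arc assms arc_def \<xi>_def cos)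
    have x: "(- 1 / s) * cos (t - \<xi>) + (1 / s - 1) = (1 - cos (t - \<xi>)) / s - 1"
      using s by (simp add: field_simps)
    have "0 \<le> (1 - cos (t - \<xi>)) / s" "(1 - cos (t - \<xi>)) / s \<le> 2"
      using c s by (auto simp: pos_divide_le_eq)
    hence "\<bar>cheb n ((- 1 / s) * cos (t - \<xi>) + (1 / s - 1))\<bar> \<le> 1"
      unfolding x by (intro abs_cheb_le_1) linarith
    hence "\<bar>cos (real n * t) - f t\<bar> \<le> 1 * s ^ n * 1"
      unfolding eq abs_mult eabs using s by (intro mult_mono) auto
    thus "\<bar>cos (real n * t) - f t\<bar> \<le> sin (\<alpha> / 2) ^ (2 * n)"
      by (simp add: s_def power_mult)
  qed
qed

section \<open>Deviation on compact subsets of the torus\<close>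

lemma slit_circle_of_torus:
  assumes "torus_compact Q" "torus_mes Q = 2 * \<alpha>" "0 < \<alpha>" "\<alpha> < pi"
  shows "slit_circle (Q \<inter> {0..<2*pi}) \<alpha>"
proof
  have Q: "closed Q" using assms(1) by (simp add: torus_compact_def)
  show E: "Q \<inter> {0..<2*pi} \<in> sets borel" using Q by auto
  show "measure lborel (Q \<inter> {0..<2*pi}) = 2 * \<alpha>"
    using assms(2) E by (simp add: torus_mes_def measure_completion)
qed (use assms closed_cis_periodic in auto)

lemma slit_circle_poly_of_torus:
  assumes "n \<ge> 1" "0 < \<alpha>" "\<alpha> < pi" "torus_compact Q" "torus_mes Q = 2 * \<alpha>"
    and "self_reciprocal n P" "M > 0" "\<And>t. t \<in> Q \<Longrightarrow> norm (poly P (cis t)) \<le> 2 * M"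
  shows "slit_circle_poly (Q \<inter> {0..<2*pi}) \<alpha> P n M"
  using assms slit_circle_of_torus[OF assms(4,5,2,3)]
  by (auto simp: slit_circle_poly_def slit_circle_poly_axioms_def self_reciprocal_def)

lemma self_reciprocal_ge:
  assumes "n \<ge> 1" "0 < \<alpha>" "\<alpha> < pi" "torus_compact Q" "torus_mes Q = 2 * \<alpha>"
    and "self_reciprocal n P" "M > 0" "\<And>t. t \<in> Q \<Longrightarrow> norm (poly P (cis t)) \<le> 2 * M"
  shows "sin (\<alpha> / 2) ^ (2 * n) \<le> M"
  by (rule slit_circle_poly.deviation_ge[OF slit_circle_poly_of_torus[OF assms]])

lemma self_reciprocal_extremal:
  assumes n: "n \<ge> 1" and \<alpha>: "0 < \<alpha>" "\<alpha> < pi" and Q: "torus_compact Q" "torus_mes Q = 2 * \<alpha>"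
    and P: "self_reciprocal n P"
    and bound: "\<And>t. t \<in> Q \<Longrightarrow> norm (poly P (cis t)) \<le> 2 * sin (\<alpha> / 2) ^ (2 * n)"
  shows "\<exists>k::int. Q = seg n \<alpha> k"
proof -
  let ?M = "sin (\<alpha> / 2) ^ (2 * n)"
  have "?M > 0" using sin_gt_zero[of "\<alpha> / 2"] \<alpha> by simp
  note poly_locale = slit_circle_poly_of_torus[OF n \<alpha> _ _ P this]
  interpret S: slit_circle_extremal "Q \<inter> {0..<2*pi}" \<alpha> P n ?M
    using poly_locale[OF Q bound]
    by (simp add: slit_circle_extremal_def slit_circle_extremal_axioms_def)
  have in_\<Omega>: "cis t \<in> S.\<Omega> \<longleftrightarrow> t \<notin> Q" for t
    using periodic_cis_iff Q(1) by (simp add: S.\<Omega>_def torus_compact_def)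
  obtain c where c: "norm c = 1"
    "\<And>p. p \<in> S.\<Omega> \<Longrightarrow> norm p = 1 \<Longrightarrow> Re (c * p) < cos \<alpha>"
    "\<And>p. p \<in> S.\<Omega> \<Longrightarrow> norm p = 1 \<Longrightarrow> c * p = - 1 \<Longrightarrow> p ^ n \<in> \<real>"
    using S.extremal_arc by blast
  obtain \<theta> where \<theta>: "c = cis \<theta>"
    using c(1) by (metis complex_unimodular_polar cis.code complex_eq_iff cis.sel complex.sel)
  \<comment> \<open>The centre of the arc is normalised to lie between \<open>pi\<close> and
    \<open>3 * pi\<close>, where \<open>torus_mes_arc\<close> applies.\<close>
  obtain m :: int where m: "pi \<le> - \<theta> - 2 * pi * of_int m" "- \<theta> - 2 * pi * of_int m < pi + 2 * pi"
    by (rule reduce_2pi)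
  define \<xi> where "\<xi> = - \<theta> - 2 * pi * of_int m"
  have "c = cis (- \<xi>)"
    using cis_add_2pi_int[of \<theta> m] \<theta> by (simp add: \<xi>_def add.commute)
  hence cp: "c * cis t = cis (t - \<xi>)" for t by (simp add: cis_mult)
  have sub: "arc \<alpha> \<xi> \<subseteq> Q"
  proof
    fix t assume "t \<in> arc \<alpha> \<xi>"
    thus "t \<in> Q" using c(2)[of "cis t"] in_\<Omega>[of t] by (auto simp: cp arc_def)
  qed
  have arc: "torus_compact (arc \<alpha> \<xi>)" "torus_mes (arc \<alpha> \<xi>) = 2 * \<alpha>"
    using m \<alpha> by (auto simp: \<xi>_def intro!: torus_compact_arc torus_mes_arc)
  \<comment> \<open>The arc has the same measure as \<open>Q\<close> and inherits the bound on
    \<open>P\<close>, so \<open>P\<close> is extremal for it as well and exceeds the bound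
    everywhere off it.\<close>
  interpret A: slit_circle_extremal "arc \<alpha> \<xi> \<inter> {0..<2*pi}" \<alpha> P n ?M
    using poly_locale[OF arc] bound sub
    by (auto simp: slit_circle_extremal_def slit_circle_extremal_axioms_def)
  have "t \<in> arc \<alpha> \<xi>" if "t \<in> Q" for t
  proof (rule ccontr)
    assume "t \<notin> arc \<alpha> \<xi>"
    hence "cis t \<in> A.\<Omega>"
      using periodic_cis_iff arc(1) by (simp add: A.\<Omega>_def torus_compact_def)
    from A.extremal_gt[OF this] bound[OF that] show False by simp
  qed
  hence Q_eq: "Q = arc \<alpha> \<xi>" using sub by blast
  \<comment> \<open>The point opposite the centre is the middle of the gap, where
    \<open>c * p = - 1\<close>.\<close>
  have "\<xi> + pi \<notin> Q"
    using cos_monotone_0_pi[of \<alpha> pi] \<alpha> by (simp add: Q_eq arc_def)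
  hence "cis (\<xi> + pi) ^ n \<in> \<real>"
    using in_\<Omega> by (intro c(3)) (auto simp: cp)
  hence "sin (real n * (\<xi> + pi)) = 0"
    by (simp add: Complex.DeMoivre complex_is_Real_iff)
  then obtain j :: int where j: "real n * (\<xi> + pi) = of_int j * pi"
    by (auto simp: sin_zero_iff_int2)
  have "\<xi> = of_int (j - int n) * pi / real n"
    using j n by (simp add: field_simps)
  thus ?thesis using Q_eq seg_eq_arc[OF \<alpha>, of n "j - int n"] by metis
qed

lemma torus_nonempty:
  assumes "torus_mes Q > 0"
  shows "Q \<noteq> {}"
  using assms by (auto simp: torus_mes_def)

lemma infinite_cis_torus:
  assumes "torus_mes Q > 0"
  shows "infinite (cis ` Q)"
proof
  assume "finite (cis ` Q)"
  hence "finite (cis ` (Q \<inter> {0..<2*pi}))" by (rule finite_subset[rotated]) auto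
  hence "finite (Q \<inter> {0..<2*pi})"
    by (rule finite_imageD) (rule inj_on_subset[OF cis_inj_on], auto)
  hence "negligible (Q \<inter> {0..<2*pi})" by (rule negligible_finite)
  hence "torus_mes Q = 0" by (simp add: torus_mes_def negligible_imp_measure0)
  thus False using assms by simp
qed

definition deviation :: "nat \<Rightarrow> real set \<Rightarrow> (real \<Rightarrow> real) \<Rightarrow> real" where
  "deviation n Q f = Sup ((\<lambda>t. \<bar>cos (real n * t) - f t\<bar>) ` Q)"

lemma deviation_upper:
  assumes "trig_poly m f" "t \<in> Q"
  shows "\<bar>cos (real n * t) - f t\<bar> \<le> deviation n Q f"
proof -
  obtain B where B: "\<And>t. \<bar>f t\<bar> \<le> B" using trig_poly_bounded[OF assms(1)] by blast
  have "\<bar>cos (real n * t) - f t\<bar> \<le> 1 + B" for t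
    using B[of t] abs_cos_le_one[of "real n * t"] by linarith
  hence "bdd_above ((\<lambda>t. \<bar>cos (real n * t) - f t\<bar>) ` Q)" by (auto intro!: bdd_aboveI2)
  thus ?thesis unfolding deviation_def using assms(2) by (intro cSup_upper) auto
qed

lemma norm_poly_le_deviation:
  assumes "\<And>t. poly P (cis t) = 2 * cis (real n * t) * of_real (cos (real n * t) - f t)"
    and "\<bar>cos (real n * t) - f t\<bar> \<le> M"
  shows "norm (poly P (cis t)) \<le> 2 * M"
  unfolding assms(1) norm_mult norm_of_real using assms(2) by simp

lemma deviation_ge_sin_power:
  assumes "n \<ge> 1" "0 < \<alpha>" "\<alpha> < pi" "torus_compact Q" "torus_mes Q = 2 * \<alpha>" "trig_poly (n - 1) f"
  shows "sin (\<alpha> / 2) ^ (2 * n) \<le> deviation n Q f"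
proof (rule ccontr)
  assume less: "\<not> sin (\<alpha> / 2) ^ (2 * n) \<le> deviation n Q f"
  have pos: "sin (\<alpha> / 2) ^ (2 * n) > 0" using sin_gt_zero[of "\<alpha> / 2"] assms by simp
  \<comment> \<open>Taking half the claimed bound as a floor keeps \<open>M\<close> positive even
    when the deviation is 0, and \<open>M\<close> still lies below that bound.\<close>
  define M where "M = max (deviation n Q f) (sin (\<alpha> / 2) ^ (2 * n) / 2)"
  obtain P where P: "self_reciprocal n P"
    "\<And>t. poly P (cis t) = 2 * cis (real n * t) * of_real (cos (real n * t) - f t)"
    using trig_poly_self_reciprocal[OF assms(1,6)] by blast
  have "sin (\<alpha> / 2) ^ (2 * n) \<le> M"
  proof (rule self_reciprocal_ge[OF assms(1-5) P(1)])
    show "M > 0" using pos by (simp add: M_def)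
    fix t assume "t \<in> Q"
    hence "\<bar>cos (real n * t) - f t\<bar> \<le> M"
      using deviation_upper[OF assms(6), of t Q n] by (simp add: M_def)
    thus "norm (poly P (cis t)) \<le> 2 * M" by (rule norm_poly_le_deviation[OF P(2)])
  qed
  thus False using less pos by (simp add: M_def)
qed

lemma U_set_eq_Inf_deviation: "U_set n Q = Inf (deviation n Q ` {f. trig_poly (n - 1) f})"
  by (simp add: U_set_def deviation_def)

lemma U_set_ge:
  assumes "n \<ge> 1" "0 < \<alpha>" "\<alpha> < pi" "torus_compact Q" "torus_mes Q = 2 * \<alpha>"
  shows "sin (\<alpha> / 2) ^ (2 * n) \<le> U_set n Q"
  unfolding U_set_eq_Inf_deviation
  using deviation_ge_sin_power[OF assms] trig_poly_const[of "n - 1" 0]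
  by (intro cInf_greatest) auto

lemma U_set_seg:
  assumes "n \<ge> 1" "0 < \<alpha>" "\<alpha> < pi" "torus_compact (seg n \<alpha> k)" "torus_mes (seg n \<alpha> k) = 2 * \<alpha>"
  shows "U_set n (seg n \<alpha> k) = sin (\<alpha> / 2) ^ (2 * n)"
proof (rule antisym[OF _ U_set_ge[OF assms]])
  obtain f where f: "trig_poly (n - 1) f"
    "\<And>t. t \<in> seg n \<alpha> k \<Longrightarrow> \<bar>cos (real n * t) - f t\<bar> \<le> sin (\<alpha> / 2) ^ (2 * n)"
    using seg_upper_bound[OF assms(1-3)] by blast
  have "bdd_below (deviation n (seg n \<alpha> k) ` {f. trig_poly (n - 1) f})"
    using deviation_ge_sin_power[OF assms] by (auto intro!: bdd_belowI2)
  hence "U_set n (seg n \<alpha> k) \<le> deviation n (seg n \<alpha> k) f"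
    unfolding U_set_eq_Inf_deviation using f(1) by (intro cInf_lower) auto
  also have "\<dots> \<le> sin (\<alpha> / 2) ^ (2 * n)"
    unfolding deviation_def using torus_nonempty[of "seg n \<alpha> k"] assms f(2)
    by (intro cSup_least) auto
  finally show "U_set n (seg n \<alpha> k) \<le> sin (\<alpha> / 2) ^ (2 * n)" .
qed

text \<open>Attainment of the infimum is not presupposed: near-optimal \<open>f\<close> give
  polynomials \<open>P i\<close>, and compactness supplies a limit satisfying the exact bound, to
  which the equality case applies.\<close>

lemma U_set_extremal:
  assumes "n \<ge> 1" "0 < \<alpha>" "\<alpha> < pi" "torus_compact Q" "torus_mes Q = 2 * \<alpha>"
    and U: "U_set n Q = sin (\<alpha> / 2) ^ (2 * n)"
  shows "\<exists>k::int. Q = seg n \<alpha> k"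
proof -
  let ?M = "sin (\<alpha> / 2) ^ (2 * n)"
  have "\<exists>P. self_reciprocal n P \<and> (\<forall>t\<in>Q. norm (poly P (cis t)) \<le> 2 * (?M + 1 / real (Suc i)))" for i
  proof -
    have "Inf (deviation n Q ` {f. trig_poly (n - 1) f}) < ?M + 1 / real (Suc i)"
      using U unfolding U_set_eq_Inf_deviation by simp
    then obtain f where f: "trig_poly (n - 1) f" "deviation n Q f < ?M + 1 / real (Suc i)"
      using cInf_lessD[of "deviation n Q ` {f. trig_poly (n - 1) f}"] trig_poly_const[of "n - 1" 0] by blast
    obtain P where P: "self_reciprocal n P"
      "\<And>t. poly P (cis t) = 2 * cis (real n * t) * of_real (cos (real n * t) - f t)"
      using trig_poly_self_reciprocal[OF assms(1) f(1)] by blast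
    have "norm (poly P (cis t)) \<le> 2 * (?M + 1 / real (Suc i))" if "t \<in> Q" for t
      using deviation_upper[OF f(1) that, of n] f(2)
      by (intro norm_poly_le_deviation[OF P(2)]) linarith
    thus ?thesis using P(1) by blast
  qed
  then obtain P where P: "\<And>i. self_reciprocal n (P i)"
    "\<And>i t. t \<in> Q \<Longrightarrow> norm (poly (P i) (cis t)) \<le> 2 * (?M + 1 / real (Suc i))"
    by metis
  have "infinite (cis ` Q)" using assms by (intro infinite_cis_torus) simp
  then obtain R where "self_reciprocal n R" "\<And>t. t \<in> Q \<Longrightarrow> norm (poly R (cis t)) \<le> 2 * ?M"
    using self_reciprocal_compactness[OF _ P] by blast
  thus ?thesis using self_reciprocal_extremal[OF assms(1-5)] by blast
qed

theorem theorem8: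
  fixes n :: nat and \<alpha> :: real
  assumes "n \<ge> 1" and "0 < \<alpha>" and "\<alpha> < pi"
  shows "(\<forall>Q. torus_compact Q \<and> torus_mes Q = 2 * \<alpha> \<longrightarrow>
            U_set n Q \<ge> sin (\<alpha> / 2) ^ (2 * n) \<and>
            (U_set n Q = sin (\<alpha> / 2) ^ (2 * n) \<longleftrightarrow> (\<exists>k::int. Q = seg n \<alpha> k)))
         \<and> U_mes n (2 * \<alpha>) = sin (\<alpha> / 2) ^ (2 * n)"
proof (intro conjI allI impI)
  fix Q assume "torus_compact Q \<and> torus_mes Q = 2 * \<alpha>"
  hence Q: "torus_compact Q" "torus_mes Q = 2 * \<alpha>" by auto
  show "U_set n Q \<ge> sin (\<alpha> / 2) ^ (2 * n)" by (rule U_set_ge[OF assms Q])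
  show "U_set n Q = sin (\<alpha> / 2) ^ (2 * n) \<longleftrightarrow> (\<exists>k::int. Q = seg n \<alpha> k)"
    using U_set_extremal[OF assms Q] U_set_seg[OF assms] Q by blast
next
  \<comment> \<open>The centre 0 is replaced by \<open>2 * pi\<close> to fall into the range of
    centres covered by \<open>torus_mes_arc\<close>.\<close>
  have seg0: "seg n \<alpha> 0 = arc \<alpha> (2 * pi)"
    using cos_periodic[of "t - 2 * pi" for t] by (simp add: seg_eq_arc[OF assms(2,3)] arc_def)
  have compact: "torus_compact (seg n \<alpha> 0)" unfolding seg0 by (rule torus_compact_arc)
  have mes: "torus_mes (seg n \<alpha> 0) = 2 * \<alpha>" unfolding seg0 using assms by (intro torus_mes_arc) auto
  have "sin (\<alpha> / 2) ^ (2 * n) \<in> {U_set n Q | Q. torus_compact Q \<and> torus_mes Q = 2 * \<alpha>}"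
    using U_set_seg[OF assms compact mes] compact mes by (metis (mono_tags, lifting) mem_Collect_eq)
  thus "U_mes n (2 * \<alpha>) = sin (\<alpha> / 2) ^ (2 * n)"
    unfolding U_mes_def by (rule cInf_eq_minimum) (use U_set_ge[OF assms] in auto)
qed

end
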